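(* Let $I$ be a small category and let $\mathbb{C}$ be a finitely complete category. If $\mathbb{C}$ is pointed protomodular (resp. homological, resp. finitely cocomplete homological, resp. semi-abelian), then so is the category $\mathbb{C}^I$ of functors from $I$ to $\mathbb{C}$ (with natural transformations as morphisms).
   Context: A category is pointed if it has a zero object $0$ (both initial and terminal). The kernel of a morphism is the equalizer of it and the zero arrow. A regular epimorphism is a morphism which is a coequalizer of some parallel pair. The kernel pair of $f$ is the pair of projections of the pullback of $f$ along itself. A category is regular if it is finitely complete, pullbacks of regular epimorphisms along arbitrary morphisms are regular epimorphisms, and kernel pairs have coequalizers. A regular category is exact if every internal equivalence relation in it is the kernel pair of some morphism. A pointed category is protomodular if it has pullbacks of split epimorphisms along any morphism and the split short five lemma holds: given split epimorphisms $q : Z \to W$ with section $r$ ($qr = 1_W$) and kernel $i : K[q] \to Z$, and $p : X \to Y$ with section $s$ ($ps = 1_Y$) and kernel $k : K[p] \to X$, and morphisms $l : K[q] \to K[p]$, $m : Z \to X$, $n : W \to Y$ with $mi = kl$, $nq = pm$, $mr = sn$, if $l$ and $n$ are isomorphisms then so is $m$. A category is homological if it is pointed, regular and protomodular. A category is semi-abelian if it is pointed, exact and protomodular and has finite sums (finite coproducts). Finitely cocomplete means having all finite colimits. *)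

theory Defs
  imports Main "HOL-Library.FuncSet"
begin

section \<open>Categories\<close>

record ('o, 'm) cat =
  Ob :: "'o set"
  Ar :: "'m set"
  Dom :: "'m \<Rightarrow> 'o"
  Cod :: "'m \<Rightarrow> 'o"
  Ide :: "'o \<Rightarrow> 'm"
  Comp :: "'m \<Rightarrow> 'm \<Rightarrow> 'm"  (infixl "\<odot>\<index>" 70)

definition hom :: "('o, 'm) cat \<Rightarrow> 'o \<Rightarrow> 'o \<Rightarrow> 'm set" where
  "hom C a b = {f \<in> Ar C. Dom C f = a \<and> Cod C f = b}"

text \<open>Objects and arrows form sets over arbitrary types, so smallness of a category needs no
  separate assumption.\<close>

locale category =
  fixes C :: "('o, 'm) cat" (structure)
  assumes dom_in_Ob: "f \<in> Ar C \<Longrightarrow> Dom C f \<in> Ob C"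
    and cod_in_Ob: "f \<in> Ar C \<Longrightarrow> Cod C f \<in> Ob C"
    and ide_in_hom: "a \<in> Ob C \<Longrightarrow> Ide C a \<in> hom C a a"
    and comp_in_hom: "f \<in> hom C a b \<Longrightarrow> g \<in> hom C b c \<Longrightarrow> g \<odot> f \<in> hom C a c"
    and comp_ide_left: "f \<in> hom C a b \<Longrightarrow> Ide C b \<odot> f = f"
    and comp_ide_right: "f \<in> hom C a b \<Longrightarrow> f \<odot> Ide C a = f"
    and comp_assoc: "f \<in> hom C a b \<Longrightarrow> g \<in> hom C b c \<Longrightarrow> h \<in> hom C c d
          \<Longrightarrow> (h \<odot> g) \<odot> f = h \<odot> (g \<odot> f)"

definition iso :: "('o, 'm) cat \<Rightarrow> 'm \<Rightarrow> bool" where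
  "iso C f \<longleftrightarrow> f \<in> Ar C \<and>
     (\<exists>g \<in> hom C (Cod C f) (Dom C f).
        g \<odot>\<^bsub>C\<^esub> f = Ide C (Dom C f) \<and> f \<odot>\<^bsub>C\<^esub> g = Ide C (Cod C f))"

section \<open>Functors, natural transformations and the functor category\<close>

record ('i, 'j, 'o, 'm) ftr =
  FOb :: "'i \<Rightarrow> 'o"
  FAr :: "'j \<Rightarrow> 'm"

text \<open>The extensional function spaces make equality of functors and of natural transformations
  agree with equality on the objects and arrows of the source category.\<close>

definition is_functor ::
    "('i, 'j) cat \<Rightarrow> ('o, 'm) cat \<Rightarrow> ('i, 'j, 'o, 'm) ftr \<Rightarrow> bool" where
  "is_functor J C F \<longleftrightarrow>
     FOb F \<in> Ob J \<rightarrow>\<^sub>E Ob C \<and>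
     FAr F \<in> Ar J \<rightarrow>\<^sub>E Ar C \<and>
     (\<forall>f \<in> Ar J. FAr F f \<in> hom C (FOb F (Dom J f)) (FOb F (Cod J f))) \<and>
     (\<forall>a \<in> Ob J. FAr F (Ide J a) = Ide C (FOb F a)) \<and>
     (\<forall>f \<in> Ar J. \<forall>g \<in> Ar J. Dom J g = Cod J f \<longrightarrow>
        FAr F (g \<odot>\<^bsub>J\<^esub> f) = FAr F g \<odot>\<^bsub>C\<^esub> FAr F f)"

record ('i, 'j, 'o, 'm) ntr =
  NDom :: "('i, 'j, 'o, 'm) ftr"
  NCod :: "('i, 'j, 'o, 'm) ftr"
  NComp :: "'i \<Rightarrow> 'm"

definition is_nat_trans ::
    "('i, 'j) cat \<Rightarrow> ('o, 'm) cat \<Rightarrow> ('i, 'j, 'o, 'm) ntr \<Rightarrow> bool" where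
  "is_nat_trans J C t \<longleftrightarrow>
     is_functor J C (NDom t) \<and> is_functor J C (NCod t) \<and>
     NComp t \<in> extensional (Ob J) \<and>
     (\<forall>a \<in> Ob J. NComp t a \<in> hom C (FOb (NDom t) a) (FOb (NCod t) a)) \<and>
     (\<forall>f \<in> Ar J. NComp t (Cod J f) \<odot>\<^bsub>C\<^esub> FAr (NDom t) f
                = FAr (NCod t) f \<odot>\<^bsub>C\<^esub> NComp t (Dom J f))"

definition functor_cat ::
    "('i, 'j) cat \<Rightarrow> ('o, 'm) cat \<Rightarrow> (('i, 'j, 'o, 'm) ftr, ('i, 'j, 'o, 'm) ntr) cat" where
  "functor_cat J C =
     \<lparr> Ob = {F. is_functor J C F},
       Ar = {t. is_nat_trans J C t},
       Dom = NDom,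
       Cod = NCod,
       Ide = (\<lambda>F. \<lparr> NDom = F, NCod = F, NComp = (\<lambda>a \<in> Ob J. Ide C (FOb F a)) \<rparr>),
       Comp = (\<lambda>s t. \<lparr> NDom = NDom t, NCod = NCod s,
                        NComp = (\<lambda>a \<in> Ob J. NComp s a \<odot>\<^bsub>C\<^esub> NComp t a) \<rparr>) \<rparr>"

section \<open>Finite limits and colimits\<close>

definition cone ::
    "('i, 'j) cat \<Rightarrow> ('o, 'm) cat \<Rightarrow> ('i, 'j, 'o, 'm) ftr \<Rightarrow> 'o \<Rightarrow> ('i \<Rightarrow> 'm) \<Rightarrow> bool" where
  "cone J C D L \<pi> \<longleftrightarrow> L \<in> Ob C \<and>
     (\<forall>a \<in> Ob J. \<pi> a \<in> hom C L (FOb D a)) \<and>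
     (\<forall>f \<in> Ar J. FAr D f \<odot>\<^bsub>C\<^esub> \<pi> (Dom J f) = \<pi> (Cod J f))"

definition limit_cone ::
    "('i, 'j) cat \<Rightarrow> ('o, 'm) cat \<Rightarrow> ('i, 'j, 'o, 'm) ftr \<Rightarrow> 'o \<Rightarrow> ('i \<Rightarrow> 'm) \<Rightarrow> bool" where
  "limit_cone J C D L \<pi> \<longleftrightarrow> cone J C D L \<pi> \<and>
     (\<forall>M \<mu>. cone J C D M \<mu> \<longrightarrow>
        (\<exists>!u. u \<in> hom C M L \<and> (\<forall>a \<in> Ob J. \<pi> a \<odot>\<^bsub>C\<^esub> u = \<mu> a)))"

definition cocone ::
    "('i, 'j) cat \<Rightarrow> ('o, 'm) cat \<Rightarrow> ('i, 'j, 'o, 'm) ftr \<Rightarrow> 'o \<Rightarrow> ('i \<Rightarrow> 'm) \<Rightarrow> bool" where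
  "cocone J C D L \<iota> \<longleftrightarrow> L \<in> Ob C \<and>
     (\<forall>a \<in> Ob J. \<iota> a \<in> hom C (FOb D a) L) \<and>
     (\<forall>f \<in> Ar J. \<iota> (Cod J f) \<odot>\<^bsub>C\<^esub> FAr D f = \<iota> (Dom J f))"

definition colimit_cocone ::
    "('i, 'j) cat \<Rightarrow> ('o, 'm) cat \<Rightarrow> ('i, 'j, 'o, 'm) ftr \<Rightarrow> 'o \<Rightarrow> ('i \<Rightarrow> 'm) \<Rightarrow> bool" where
  "colimit_cocone J C D L \<iota> \<longleftrightarrow> cocone J C D L \<iota> \<and>
     (\<forall>M \<mu>. cocone J C D M \<mu> \<longrightarrow>
        (\<exists>!u. u \<in> hom C L M \<and> (\<forall>a \<in> Ob J. u \<odot>\<^bsub>C\<^esub> \<iota> a = \<mu> a)))"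

definition finite_cat :: "('o, 'm) cat \<Rightarrow> bool" where
  "finite_cat J \<longleftrightarrow> category J \<and> finite (Ob J) \<and> finite (Ar J)"

text \<open>Index categories carried by the natural numbers suffice, since every finite category is
  isomorphic to one of these; a definition cannot quantify over types.\<close>

definition finitely_complete :: "('o, 'm) cat \<Rightarrow> bool" where
  "finitely_complete C \<longleftrightarrow>
     (\<forall>(J :: (nat, nat) cat) D. finite_cat J \<and> is_functor J C D \<longrightarrow> (\<exists>L \<pi>. limit_cone J C D L \<pi>))"

definition finitely_cocomplete :: "('o, 'm) cat \<Rightarrow> bool" where
  "finitely_cocomplete C \<longleftrightarrow>
     (\<forall>(J :: (nat, nat) cat) D. finite_cat J \<and> is_functor J C D \<longrightarrow> (\<exists>L \<iota>. colimit_cocone J C D L \<iota>))"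

definition coproduct ::
    "('o, 'm) cat \<Rightarrow> 'k set \<Rightarrow> ('k \<Rightarrow> 'o) \<Rightarrow> 'o \<Rightarrow> ('k \<Rightarrow> 'm) \<Rightarrow> bool" where
  "coproduct C K X S \<iota> \<longleftrightarrow> S \<in> Ob C \<and>
     (\<forall>k \<in> K. \<iota> k \<in> hom C (X k) S) \<and>
     (\<forall>T \<mu>. T \<in> Ob C \<and> (\<forall>k \<in> K. \<mu> k \<in> hom C (X k) T) \<longrightarrow>
        (\<exists>!u. u \<in> hom C S T \<and> (\<forall>k \<in> K. u \<odot>\<^bsub>C\<^esub> \<iota> k = \<mu> k)))"

definition has_finite_coproducts :: "('o, 'm) cat \<Rightarrow> bool" where
  "has_finite_coproducts C \<longleftrightarrow>
     (\<forall>(n :: nat) X. (\<forall>k < n. X k \<in> Ob C) \<longrightarrow> (\<exists>S \<iota>. coproduct C {..<n} X S \<iota>))"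

definition equalizer :: "('o, 'm) cat \<Rightarrow> 'm \<Rightarrow> 'm \<Rightarrow> 'm \<Rightarrow> bool" where
  "equalizer C e f g \<longleftrightarrow>
     f \<in> Ar C \<and> g \<in> hom C (Dom C f) (Cod C f) \<and>
     e \<in> Ar C \<and> Cod C e = Dom C f \<and> f \<odot>\<^bsub>C\<^esub> e = g \<odot>\<^bsub>C\<^esub> e \<and>
     (\<forall>h \<in> Ar C. Cod C h = Dom C f \<and> f \<odot>\<^bsub>C\<^esub> h = g \<odot>\<^bsub>C\<^esub> h \<longrightarrow>
        (\<exists>!u. u \<in> hom C (Dom C h) (Dom C e) \<and> e \<odot>\<^bsub>C\<^esub> u = h))"

definition coequalizer :: "('o, 'm) cat \<Rightarrow> 'm \<Rightarrow> 'm \<Rightarrow> 'm \<Rightarrow> bool" where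
  "coequalizer C q f g \<longleftrightarrow>
     f \<in> Ar C \<and> g \<in> hom C (Dom C f) (Cod C f) \<and>
     q \<in> Ar C \<and> Dom C q = Cod C f \<and> q \<odot>\<^bsub>C\<^esub> f = q \<odot>\<^bsub>C\<^esub> g \<and>
     (\<forall>h \<in> Ar C. Dom C h = Cod C f \<and> h \<odot>\<^bsub>C\<^esub> f = h \<odot>\<^bsub>C\<^esub> g \<longrightarrow>
        (\<exists>!u. u \<in> hom C (Cod C q) (Cod C h) \<and> u \<odot>\<^bsub>C\<^esub> q = h))"

text \<open>In \<open>pullback C p q f g\<close> the square is \<open>f \<odot> p = g \<odot> q\<close>; thus \<open>p\<close> is the pullback of \<open>g\<close> along \<open>f\<close>,
  and \<open>q\<close> is the pullback of \<open>f\<close> along \<open>g\<close>.\<close>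

definition pullback :: "('o, 'm) cat \<Rightarrow> 'm \<Rightarrow> 'm \<Rightarrow> 'm \<Rightarrow> 'm \<Rightarrow> bool" where
  "pullback C p q f g \<longleftrightarrow>
     f \<in> Ar C \<and> g \<in> Ar C \<and> Cod C f = Cod C g \<and>
     p \<in> Ar C \<and> q \<in> Ar C \<and> Dom C p = Dom C q \<and> Cod C p = Dom C f \<and> Cod C q = Dom C g \<and>
     f \<odot>\<^bsub>C\<^esub> p = g \<odot>\<^bsub>C\<^esub> q \<and>
     (\<forall>T. \<forall>x \<in> hom C T (Dom C f). \<forall>y \<in> hom C T (Dom C g). f \<odot>\<^bsub>C\<^esub> x = g \<odot>\<^bsub>C\<^esub> y \<longrightarrow>
        (\<exists>!u. u \<in> hom C T (Dom C p) \<and> p \<odot>\<^bsub>C\<^esub> u = x \<and> q \<odot>\<^bsub>C\<^esub> u = y))"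

section \<open>Pointed, regular and exact categories\<close>

definition initial_object :: "('o, 'm) cat \<Rightarrow> 'o \<Rightarrow> bool" where
  "initial_object C z \<longleftrightarrow> z \<in> Ob C \<and> (\<forall>a \<in> Ob C. \<exists>!f. f \<in> hom C z a)"

definition terminal_object :: "('o, 'm) cat \<Rightarrow> 'o \<Rightarrow> bool" where
  "terminal_object C z \<longleftrightarrow> z \<in> Ob C \<and> (\<forall>a \<in> Ob C. \<exists>!f. f \<in> hom C a z)"

definition zero_object :: "('o, 'm) cat \<Rightarrow> 'o \<Rightarrow> bool" where
  "zero_object C z \<longleftrightarrow> initial_object C z \<and> terminal_object C z"

definition pointed :: "('o, 'm) cat \<Rightarrow> bool" where
  "pointed C \<longleftrightarrow> category C \<and> (\<exists>z. zero_object C z)"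

definition zero_arrow :: "('o, 'm) cat \<Rightarrow> 'm \<Rightarrow> bool" where
  "zero_arrow C f \<longleftrightarrow> f \<in> Ar C \<and>
     (\<exists>z. zero_object C z \<and>
        (\<exists>t \<in> hom C (Dom C f) z. \<exists>i \<in> hom C z (Cod C f). f = i \<odot>\<^bsub>C\<^esub> t))"

definition kernel :: "('o, 'm) cat \<Rightarrow> 'm \<Rightarrow> 'm \<Rightarrow> bool" where
  "kernel C k f \<longleftrightarrow> (\<exists>z. zero_arrow C z \<and> equalizer C k f z)"

definition regular_epi :: "('o, 'm) cat \<Rightarrow> 'm \<Rightarrow> bool" where
  "regular_epi C q \<longleftrightarrow> (\<exists>f g. coequalizer C q f g)"

definition kernel_pair :: "('o, 'm) cat \<Rightarrow> 'm \<Rightarrow> 'm \<Rightarrow> 'm \<Rightarrow> bool" where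
  "kernel_pair C p q f \<longleftrightarrow> pullback C p q f f"

definition regular :: "('o, 'm) cat \<Rightarrow> bool" where
  "regular C \<longleftrightarrow> category C \<and> finitely_complete C \<and>
     (\<forall>p q f g. pullback C p q f g \<and> regular_epi C g \<longrightarrow> regular_epi C p) \<and>
     (\<forall>p q f. kernel_pair C p q f \<longrightarrow> (\<exists>c. coequalizer C c p q))"

definition jointly_monic :: "('o, 'm) cat \<Rightarrow> 'm \<Rightarrow> 'm \<Rightarrow> bool" where
  "jointly_monic C d e \<longleftrightarrow>
     (\<forall>T. \<forall>x \<in> hom C T (Dom C d). \<forall>y \<in> hom C T (Dom C d).
        d \<odot>\<^bsub>C\<^esub> x = d \<odot>\<^bsub>C\<^esub> y \<and> e \<odot>\<^bsub>C\<^esub> x = e \<odot>\<^bsub>C\<^esub> y \<longrightarrow> x = y)"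

text \<open>An internal equivalence relation on \<open>X\<close> is a jointly monic parallel pair \<open>d, e : R \<rightarrow> X\<close>
  together with arrows witnessing reflexivity, symmetry and transitivity; the latter is defined on
  the object \<open>R \<times>\<^sub>X R\<close> of composable pairs, the pullback of \<open>e\<close> and \<open>d\<close>.\<close>

definition internal_equivalence :: "('o, 'm) cat \<Rightarrow> 'm \<Rightarrow> 'm \<Rightarrow> bool" where
  "internal_equivalence C d e \<longleftrightarrow>
     d \<in> Ar C \<and> e \<in> hom C (Dom C d) (Cod C d) \<and> jointly_monic C d e \<and>
     (\<exists>r \<in> hom C (Cod C d) (Dom C d).
        d \<odot>\<^bsub>C\<^esub> r = Ide C (Cod C d) \<and> e \<odot>\<^bsub>C\<^esub> r = Ide C (Cod C d)) \<and>
     (\<exists>s \<in> hom C (Dom C d) (Dom C d). d \<odot>\<^bsub>C\<^esub> s = e \<and> e \<odot>\<^bsub>C\<^esub> s = d) \<and>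
     (\<exists>p q. pullback C p q e d \<and>
        (\<exists>t \<in> hom C (Dom C p) (Dom C d). d \<odot>\<^bsub>C\<^esub> t = d \<odot>\<^bsub>C\<^esub> p \<and> e \<odot>\<^bsub>C\<^esub> t = e \<odot>\<^bsub>C\<^esub> q))"

definition exact :: "('o, 'm) cat \<Rightarrow> bool" where
  "exact C \<longleftrightarrow> regular C \<and>
     (\<forall>d e. internal_equivalence C d e \<longrightarrow> (\<exists>f. kernel_pair C d e f))"

section \<open>Protomodular, homological and semi-abelian categories\<close>

definition split_epi :: "('o, 'm) cat \<Rightarrow> 'm \<Rightarrow> 'm \<Rightarrow> bool" where
  "split_epi C q r \<longleftrightarrow>
     q \<in> Ar C \<and> r \<in> hom C (Cod C q) (Dom C q) \<and> q \<odot>\<^bsub>C\<^esub> r = Ide C (Cod C q)"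

definition has_pullbacks_of_split_epis :: "('o, 'm) cat \<Rightarrow> bool" where
  "has_pullbacks_of_split_epis C \<longleftrightarrow>
     (\<forall>f g r. f \<in> Ar C \<and> split_epi C g r \<and> Cod C f = Cod C g \<longrightarrow> (\<exists>p q. pullback C p q f g))"

definition split_short_five_lemma :: "('o, 'm) cat \<Rightarrow> bool" where
  "split_short_five_lemma C \<longleftrightarrow>
     (\<forall>q r i p s k l m n.
        split_epi C q r \<and> kernel C i q \<and>
        split_epi C p s \<and> kernel C k p \<and>
        l \<in> hom C (Dom C i) (Dom C k) \<and>
        m \<in> hom C (Dom C q) (Dom C p) \<and>
        n \<in> hom C (Cod C q) (Cod C p) \<and>
        m \<odot>\<^bsub>C\<^esub> i = k \<odot>\<^bsub>C\<^esub> l \<and> n \<odot>\<^bsub>C\<^esub> q = p \<odot>\<^bsub>C\<^esub> m \<and> m \<odot>\<^bsub>C\<^esub> r = s \<odot>\<^bsub>C\<^esub> n \<and>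
        iso C l \<and> iso C n
        \<longrightarrow> iso C m)"

definition pointed_protomodular :: "('o, 'm) cat \<Rightarrow> bool" where
  "pointed_protomodular C \<longleftrightarrow>
     pointed C \<and> has_pullbacks_of_split_epis C \<and> split_short_five_lemma C"

definition homological :: "('o, 'm) cat \<Rightarrow> bool" where
  "homological C \<longleftrightarrow> pointed C \<and> regular C \<and> pointed_protomodular C"

definition semi_abelian :: "('o, 'm) cat \<Rightarrow> bool" where
  "semi_abelian C \<longleftrightarrow>
     pointed C \<and> exact C \<and> pointed_protomodular C \<and> has_finite_coproducts C"

end

theory Submission
  imports Defs
begin

text \<open>Everything in the functor category \<open>C\<^sup>I\<close> that is defined by a universal property is computed
  pointwise: if the required (co)limits exist in \<open>C\<close> at every object of \<open>I\<close>, they assemble to a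
  (co)limit in the functor category (\<open>pointwise_solution_exists\<close>, \<open>universal_if_pointwise\<close>), and since
  (co)limits are unique up to isomorphism, every (co)limit of the same shape is then preserved by
  evaluation (\<open>universal_pointwise\<close>). Isomorphisms are detected pointwise as well. This transfers zero
  objects, finite limits and colimits, kernels, pullbacks of split epimorphisms and, from these, the
  split short five lemma.

  The difficulty lies in regularity and exactness. A regular category \<open>C\<close> need not have all
  coequalizers, so a coequalizer in the functor category is not obviously a coequalizer pointwise. A
  regular epimorphism is, however, the coequalizer of its own kernel pair (\<open>coequalizer_of_kernel_pair\<close>).
  Kernel pairs are finite limits, hence pointwise, and their coequalizers exist in \<open>C\<close>, hence are
  pointwise too; so regular epimorphisms are exactly the pointwise ones (\<open>regular_epi_iff_pointwise\<close>), and
  their stability under pullback follows.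

  For exactness, an internal equivalence relation \<open>(d, e)\<close> in the functor category is one pointwise. Joint
  monicity evaluates correctly because it, too, says that a certain cone is a limit
  (\<open>jointly_monic_iff_universal\<close>). At each object of \<open>I\<close> the relation is thus the kernel pair of some arrow,
  and also of the coequalizer of \<open>d\<close> and \<open>e\<close> (\<open>kernel_pair_of_coequalizer\<close>). The latter is natural, which
  gives one transformation with kernel pair \<open>(d, e)\<close>.

  Limits of all shapes are handled together as universal solutions of systems of equations between
  arrows, and colimits by duality.\<close>

section \<open>Opposite categories\<close>

definition opp :: "('o, 'm) cat \<Rightarrow> ('o, 'm) cat" where
  "opp C = \<lparr> Ob = Ob C, Ar = Ar C, Dom = Cod C, Cod = Dom C, Ide = Ide C,
             Comp = (\<lambda>g f. f \<odot>\<^bsub>C\<^esub> g) \<rparr>"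

lemma opp_simps [simp]:
  "Ob (opp C) = Ob C" "Ar (opp C) = Ar C" "Dom (opp C) = Cod C" "Cod (opp C) = Dom C"
  "Ide (opp C) = Ide C" "g \<odot>\<^bsub>opp C\<^esub> f = f \<odot>\<^bsub>C\<^esub> g"
  by (simp_all add: opp_def)

lemma hom_opp [simp]: "hom (opp C) a b = hom C b a"
  by (auto simp: hom_def)

lemma opp_opp [simp]: "opp (opp C) = (C :: ('o, 'm) cat)"
  by (simp add: opp_def)

lemma homD:
  assumes "f \<in> hom C a b"
  shows "f \<in> Ar C" "Dom C f = a" "Cod C f = b"
  using assms by (auto simp: hom_def)

lemma hom_self: "f \<in> Ar C \<Longrightarrow> f \<in> hom C (Dom C f) (Cod C f)"
  by (simp add: hom_def)

context category
begin

lemma hom_Ob: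
  assumes "f \<in> hom C a b"
  shows "a \<in> Ob C" "b \<in> Ob C"
  using assms dom_in_Ob cod_in_Ob by (auto simp: hom_def)

lemma category_opp: "category (opp C)"
proof
  show "(h \<odot>\<^bsub>opp C\<^esub> g) \<odot>\<^bsub>opp C\<^esub> f = h \<odot>\<^bsub>opp C\<^esub> (g \<odot>\<^bsub>opp C\<^esub> f)"
    if "f \<in> hom (opp C) a b" "g \<in> hom (opp C) b c" "h \<in> hom (opp C) c d" for f g h a b c d
    using that comp_assoc[of h d c g b f a] by simp
qed (auto simp: dom_in_Ob cod_in_Ob ide_in_hom comp_in_hom comp_ide_left comp_ide_right)

end

lemma is_functor_opp: "is_functor (opp J) (opp C) F \<longleftrightarrow> is_functor J C F"
  by (auto simp: is_functor_def)

lemma finite_cat_opp: "finite_cat J \<Longrightarrow> finite_cat (opp J)"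
  using category.category_opp by (auto simp: finite_cat_def)

lemma coequalizer_opp: "coequalizer C q f g \<longleftrightarrow> equalizer (opp C) q f g"
  by (simp add: coequalizer_def equalizer_def)

lemma initial_opp: "initial_object C z \<longleftrightarrow> terminal_object (opp C) z"
  by (simp add: initial_object_def terminal_object_def)

lemma colimit_cocone_opp: "colimit_cocone J C D L \<iota> \<longleftrightarrow> limit_cone (opp J) (opp C) D L \<iota>"
  by (simp add: colimit_cocone_def limit_cone_def cocone_def cone_def)

lemma finitely_cocomplete_opp:
  fixes C :: "('o, 'm) cat"
  shows "finitely_cocomplete C \<longleftrightarrow> finitely_complete (opp C)"
proof
  assume C: "finitely_cocomplete C"
  show "finitely_complete (opp C)"
    unfolding finitely_complete_def
  proof (intro allI impI)
    fix J :: "(nat, nat) cat" and D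
    assume "finite_cat J \<and> is_functor J (opp C) D"
    then have "finite_cat (opp J) \<and> is_functor (opp J) C D"
      using finite_cat_opp[of J] is_functor_opp[of "opp J" C D] by simp
    then obtain L \<iota> where "colimit_cocone (opp J) C D L \<iota>"
      using C unfolding finitely_cocomplete_def by blast
    then show "\<exists>L \<pi>. limit_cone J (opp C) D L \<pi>"
      by (auto simp: colimit_cocone_opp)
  qed
next
  assume C: "finitely_complete (opp C)"
  show "finitely_cocomplete C"
    unfolding finitely_cocomplete_def
  proof (intro allI impI)
    fix J :: "(nat, nat) cat" and D
    assume "finite_cat J \<and> is_functor J C D"
    then have "finite_cat (opp J) \<and> is_functor (opp J) (opp C) D"
      using finite_cat_opp[of J] is_functor_opp[of J C D] by simp
    then obtain L \<iota> where "limit_cone (opp J) (opp C) D L \<iota>"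
      using C unfolding finitely_complete_def by blast
    then show "\<exists>L \<iota>. colimit_cocone J C D L \<iota>"
      by (auto simp: colimit_cocone_opp)
  qed
qed

section \<open>Universal solutions of systems of equations\<close>

text \<open>A system consists of unknowns \<open>k \<in> K\<close>, standing for arrows from a common domain to \<open>X k\<close>, and of
  equations: a quadruple \<open>(s, f, t, g)\<close> demands that \<open>f\<close> after the unknown \<open>s\<close> equals \<open>g\<close> after the
  unknown \<open>t\<close>. Terminal objects, equalizers, pullbacks, limits of diagrams and, in the opposite
  category, the corresponding colimits are all universal solutions of such systems, so what evaluation
  does to them has to be shown only once.\<close>

definition eq_system ::
    "('o, 'm) cat \<Rightarrow> 'k set \<Rightarrow> ('k \<Rightarrow> 'o) \<Rightarrow> ('k \<times> 'm \<times> 'k \<times> 'm) set \<Rightarrow> bool" where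
  "eq_system C K X E \<longleftrightarrow> (\<forall>k \<in> K. X k \<in> Ob C) \<and>
     (\<forall>(s, f, t, g) \<in> E. s \<in> K \<and> t \<in> K \<and> (\<exists>y. f \<in> hom C (X s) y \<and> g \<in> hom C (X t) y))"

definition solution ::
    "('o, 'm) cat \<Rightarrow> 'k set \<Rightarrow> ('k \<Rightarrow> 'o) \<Rightarrow> ('k \<times> 'm \<times> 'k \<times> 'm) set \<Rightarrow> 'o \<Rightarrow> ('k \<Rightarrow> 'm) \<Rightarrow> bool"
  where
  "solution C K X E M \<mu> \<longleftrightarrow> M \<in> Ob C \<and> (\<forall>k \<in> K. \<mu> k \<in> hom C M (X k)) \<and>
     (\<forall>(s, f, t, g) \<in> E. f \<odot>\<^bsub>C\<^esub> \<mu> s = g \<odot>\<^bsub>C\<^esub> \<mu> t)"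

definition universal_solution ::
    "('o, 'm) cat \<Rightarrow> 'k set \<Rightarrow> ('k \<Rightarrow> 'o) \<Rightarrow> ('k \<times> 'm \<times> 'k \<times> 'm) set \<Rightarrow> 'o \<Rightarrow> ('k \<Rightarrow> 'm) \<Rightarrow> bool"
  where
  "universal_solution C K X E L \<pi> \<longleftrightarrow> solution C K X E L \<pi> \<and>
     (\<forall>M \<mu>. solution C K X E M \<mu> \<longrightarrow>
        (\<exists>!u. u \<in> hom C M L \<and> (\<forall>k \<in> K. \<pi> k \<odot>\<^bsub>C\<^esub> u = \<mu> k)))"

definition solvable ::
    "('o, 'm) cat \<Rightarrow> 'k set \<Rightarrow> ('k \<Rightarrow> 'o) \<Rightarrow> ('k \<times> 'm \<times> 'k \<times> 'm) set \<Rightarrow> bool" where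
  "solvable C K X E \<longleftrightarrow> (\<exists>L \<pi>. universal_solution C K X E L \<pi>)"

lemma eq_systemD:
  assumes "eq_system C K X E" "(s, f, t, g) \<in> E"
  obtains y where "s \<in> K" "t \<in> K" "f \<in> hom C (X s) y" "g \<in> hom C (X t) y"
  using assms that unfolding eq_system_def by fastforce

lemma universal_solutionD:
  assumes "universal_solution C K X E L \<pi>" "k \<in> K"
  shows "L \<in> Ob C" "\<pi> k \<in> hom C L (X k)"
  using assms unfolding universal_solution_def solution_def by blast+

lemma universal_factor:
  assumes "universal_solution C K X E L \<pi>" "solution C K X E M \<mu>"
  obtains u where "u \<in> hom C M L" "\<And>k. k \<in> K \<Longrightarrow> \<pi> k \<odot>\<^bsub>C\<^esub> u = \<mu> k"
  using assms unfolding universal_solution_def by (metis (no_types, lifting))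

context category
begin

lemma solution_comp:
  assumes E: "eq_system C K X E" and \<mu>: "solution C K X E M \<mu>" and v: "v \<in> hom C N M"
  shows "solution C K X E N (\<lambda>k. \<mu> k \<odot> v)"
  unfolding solution_def
proof (intro conjI ballI)
  show "N \<in> Ob C" using v hom_Ob by blast
  show "\<mu> k \<odot> v \<in> hom C N (X k)" if "k \<in> K" for k
    using \<mu> that v comp_in_hom unfolding solution_def by blast
  fix e assume e: "e \<in> E"
  obtain s f t g where [simp]: "e = (s, f, t, g)" by (cases e)
  obtain y where y: "s \<in> K" "t \<in> K" "f \<in> hom C (X s) y" "g \<in> hom C (X t) y"
    using E e by (auto elim: eq_systemD)
  have "f \<odot> (\<mu> s \<odot> v) = (f \<odot> \<mu> s) \<odot> v" "g \<odot> (\<mu> t \<odot> v) = (g \<odot> \<mu> t) \<odot> v"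
    using comp_assoc[OF v] y \<mu> unfolding solution_def by metis+
  moreover have "f \<odot> \<mu> s = g \<odot> \<mu> t" using \<mu> e unfolding solution_def by auto
  ultimately show "case e of (s, f, t, g) \<Rightarrow> f \<odot> (\<mu> s \<odot> v) = g \<odot> (\<mu> t \<odot> v)" by simp
qed

lemma universal_eqI:
  assumes E: "eq_system C K X E" and U: "universal_solution C K X E L \<pi>"
    and u: "u \<in> hom C M L" and v: "v \<in> hom C M L"
    and eq: "\<And>k. k \<in> K \<Longrightarrow> \<pi> k \<odot> u = \<pi> k \<odot> v"
  shows "u = v"
proof -
  have "solution C K X E M (\<lambda>k. \<pi> k \<odot> v)"
    using solution_comp[OF E _ v] U unfolding universal_solution_def by blast
  then have "\<exists>!w. w \<in> hom C M L \<and> (\<forall>k \<in> K. \<pi> k \<odot> w = \<pi> k \<odot> v)"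
    using U unfolding universal_solution_def by blast
  then show ?thesis using u v eq by metis
qed

lemma isoI:
  assumes "u \<in> hom C a b" "v \<in> hom C b a" "v \<odot> u = Ide C a" "u \<odot> v = Ide C b"
  shows "iso C u"
  using assms unfolding iso_def hom_def by auto

lemma isoE:
  assumes "iso C u" "u \<in> hom C a b"
  obtains v where "v \<in> hom C b a" "v \<odot> u = Ide C a" "u \<odot> v = Ide C b"
  using assms unfolding iso_def hom_def by auto

text \<open>Universal solutions are unique up to isomorphism, and every object isomorphic to one carries
  one; these two facts later transport universality between an arbitrary universal solution and the one
  constructed pointwise.\<close>

lemma universal_unique:
  assumes E: "eq_system C K X E" and L: "universal_solution C K X E L \<pi>"
    and L': "universal_solution C K X E L' \<pi>'"
  obtains u where "u \<in> hom C L L'" "iso C u" "\<And>k. k \<in> K \<Longrightarrow> \<pi>' k \<odot> u = \<pi> k"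
proof -
  have S: "solution C K X E L \<pi>" "solution C K X E L' \<pi>'"
    using L L' unfolding universal_solution_def by blast+
  obtain u where u: "u \<in> hom C L L'" "\<And>k. k \<in> K \<Longrightarrow> \<pi>' k \<odot> u = \<pi> k"
    using universal_factor[OF L' S(1)] by blast
  obtain v where v: "v \<in> hom C L' L" "\<And>k. k \<in> K \<Longrightarrow> \<pi> k \<odot> v = \<pi>' k"
    using universal_factor[OF L S(2)] by blast
  have hom: "k \<in> K \<Longrightarrow> \<pi> k \<in> hom C L (X k)" "k \<in> K \<Longrightarrow> \<pi>' k \<in> hom C L' (X k)" for k
    using S unfolding solution_def by blast+
  have "v \<odot> u = Ide C L"
  proof (rule universal_eqI[OF E L])
    show "v \<odot> u \<in> hom C L L" using u v comp_in_hom by blast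
    show "Ide C L \<in> hom C L L" using u hom_Ob ide_in_hom by blast
    show "\<pi> k \<odot> (v \<odot> u) = \<pi> k \<odot> Ide C L" if "k \<in> K" for k
      using that hom comp_assoc[OF u(1) v(1)] comp_ide_right u(2) v(2) by metis
  qed
  moreover have "u \<odot> v = Ide C L'"
  proof (rule universal_eqI[OF E L'])
    show "u \<odot> v \<in> hom C L' L'" using u v comp_in_hom by blast
    show "Ide C L' \<in> hom C L' L'" using u hom_Ob ide_in_hom by blast
    show "\<pi>' k \<odot> (u \<odot> v) = \<pi>' k \<odot> Ide C L'" if "k \<in> K" for k
      using that hom comp_assoc[OF v(1) u(1)] comp_ide_right u(2) v(2) by metis
  qed
  ultimately show thesis using that u isoI v(1) by blast
qed

lemma universal_iso:
  assumes E: "eq_system C K X E" and L': "universal_solution C K X E L' \<pi>'"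
    and u: "u \<in> hom C L L'" "iso C u" and \<pi>: "\<And>k. k \<in> K \<Longrightarrow> \<pi>' k \<odot> u = \<pi> k"
  shows "universal_solution C K X E L \<pi>"
proof -
  obtain v where v: "v \<in> hom C L' L" "v \<odot> u = Ide C L" "u \<odot> v = Ide C L'"
    using isoE[OF u(2,1)] by blast
  have hom': "k \<in> K \<Longrightarrow> \<pi>' k \<in> hom C L' (X k)" for k
    using L' unfolding universal_solution_def solution_def by blast
  have "solution C K X E L (\<lambda>k. \<pi>' k \<odot> u)"
    using solution_comp[OF E _ u(1)] L' unfolding universal_solution_def by blast
  then have S: "solution C K X E L \<pi>"
    using \<pi> E unfolding solution_def eq_system_def by fastforce
  show ?thesis
    unfolding universal_solution_def
  proof (intro conjI S allI impI)
    fix M \<mu> assume \<mu>: "solution C K X E M \<mu>"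
    obtain w where w: "w \<in> hom C M L'" "\<And>k. k \<in> K \<Longrightarrow> \<pi>' k \<odot> w = \<mu> k"
      using universal_factor[OF L' \<mu>] by blast
    have uvw: "u \<odot> (v \<odot> w) = w" using comp_assoc[OF w(1) v(1) u(1)] v(3) comp_ide_left[OF w(1)]
      by metis
    show "\<exists>!u. u \<in> hom C M L \<and> (\<forall>k\<in>K. \<pi> k \<odot> u = \<mu> k)"
    proof (intro ex1I[of _ "v \<odot> w"] conjI ballI)
      show vw: "v \<odot> w \<in> hom C M L" using comp_in_hom w v by blast
      show "\<pi> k \<odot> (v \<odot> w) = \<mu> k" if "k \<in> K" for k
        using comp_assoc[OF vw u(1) hom'] that \<pi> w(2) uvw by metis
      fix x assume x: "x \<in> hom C M L \<and> (\<forall>k\<in>K. \<pi> k \<odot> x = \<mu> k)"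
      have "u \<odot> x = w"
      proof (rule universal_eqI[OF E L'])
        show "u \<odot> x \<in> hom C M L'" using x u comp_in_hom by blast
        show "\<pi>' k \<odot> (u \<odot> x) = \<pi>' k \<odot> w" if "k \<in> K" for k
          using comp_assoc[of x M L u L' "\<pi>' k"] u(1) hom' x \<pi> w(2) that by metis
      qed (use w in blast)
      then show "x = v \<odot> w"
        using comp_assoc[of x M L u L' v L] x u(1) v comp_ide_left by metis
    qed
  qed
qed

end

section \<open>Categories of functors, described by evaluation\<close>

text \<open>The category of functors from \<open>I\<close> to \<open>C\<close> is described here only through the values of functors on
  objects (\<open>obj\<close>) and on arrows (\<open>act\<close>) and through the components of transformations (\<open>cmp\<close>). The
  axioms are self-dual: they pass to the opposites of all three categories. The opposite of the category built from
  the records \<open>ntr\<close> is not literally a category of such records between the opposite categories, since a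
  record stores its domain and codomain in a fixed order; with the abstract description every theorem
  about limits is nevertheless also one about colimits.\<close>

locale functor_category = I: category I + C: category C + D: category D
  for I :: "('i, 'j) cat" and C :: "('o, 'm) cat" and D :: "('d, 'e) cat" +
  fixes obj :: "'d \<Rightarrow> 'i \<Rightarrow> 'o" and act :: "'d \<Rightarrow> 'j \<Rightarrow> 'm" and cmp :: "'e \<Rightarrow> 'i \<Rightarrow> 'm"
  assumes obj_Ob: "F \<in> Ob D \<Longrightarrow> a \<in> Ob I \<Longrightarrow> obj F a \<in> Ob C"
    and act_hom: "F \<in> Ob D \<Longrightarrow> f \<in> hom I a b \<Longrightarrow> act F f \<in> hom C (obj F a) (obj F b)"
    and act_ide: "F \<in> Ob D \<Longrightarrow> a \<in> Ob I \<Longrightarrow> act F (Ide I a) = Ide C (obj F a)"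
    and act_comp: "F \<in> Ob D \<Longrightarrow> f \<in> hom I a b \<Longrightarrow> g \<in> hom I b c
          \<Longrightarrow> act F (g \<odot>\<^bsub>I\<^esub> f) = act F g \<odot>\<^bsub>C\<^esub> act F f"
    and functor_exists: "(\<And>a. a \<in> Ob I \<Longrightarrow> X a \<in> Ob C)
          \<Longrightarrow> (\<And>f a b. f \<in> hom I a b \<Longrightarrow> \<phi> f \<in> hom C (X a) (X b))
          \<Longrightarrow> (\<And>a. a \<in> Ob I \<Longrightarrow> \<phi> (Ide I a) = Ide C (X a))
          \<Longrightarrow> (\<And>f g a b c. f \<in> hom I a b \<Longrightarrow> g \<in> hom I b c
                 \<Longrightarrow> \<phi> (g \<odot>\<^bsub>I\<^esub> f) = \<phi> g \<odot>\<^bsub>C\<^esub> \<phi> f)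
          \<Longrightarrow> \<exists>F \<in> Ob D. (\<forall>a \<in> Ob I. obj F a = X a) \<and> (\<forall>f \<in> Ar I. act F f = \<phi> f)"
    and cmp_hom: "t \<in> hom D F G \<Longrightarrow> a \<in> Ob I \<Longrightarrow> cmp t a \<in> hom C (obj F a) (obj G a)"
    and cmp_natural: "t \<in> hom D F G \<Longrightarrow> f \<in> hom I a b
          \<Longrightarrow> cmp t b \<odot>\<^bsub>C\<^esub> act F f = act G f \<odot>\<^bsub>C\<^esub> cmp t a"
    and transformation_exists: "F \<in> Ob D \<Longrightarrow> G \<in> Ob D
          \<Longrightarrow> (\<And>a. a \<in> Ob I \<Longrightarrow> \<tau> a \<in> hom C (obj F a) (obj G a))
          \<Longrightarrow> (\<And>f a b. f \<in> hom I a b \<Longrightarrow> \<tau> b \<odot>\<^bsub>C\<^esub> act F f = act G f \<odot>\<^bsub>C\<^esub> \<tau> a)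
          \<Longrightarrow> \<exists>t \<in> hom D F G. \<forall>a \<in> Ob I. cmp t a = \<tau> a"
    and transformation_eqI: "s \<in> hom D F G \<Longrightarrow> t \<in> hom D F G
          \<Longrightarrow> (\<And>a. a \<in> Ob I \<Longrightarrow> cmp s a = cmp t a) \<Longrightarrow> s = t"
    and cmp_comp: "s \<in> hom D F G \<Longrightarrow> t \<in> hom D G H \<Longrightarrow> a \<in> Ob I
          \<Longrightarrow> cmp (t \<odot>\<^bsub>D\<^esub> s) a = cmp t a \<odot>\<^bsub>C\<^esub> cmp s a"
    and cmp_ide: "F \<in> Ob D \<Longrightarrow> a \<in> Ob I \<Longrightarrow> cmp (Ide D F) a = Ide C (obj F a)"
begin

lemma functor_category_opp: "functor_category (opp I) (opp C) (opp D) obj act cmp"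
proof -
  interpret Io: category "opp I" by (rule I.category_opp)
  interpret Co: category "opp C" by (rule C.category_opp)
  interpret Do: category "opp D" by (rule D.category_opp)
  show ?thesis
  proof
    show "\<exists>F\<in>Ob (opp D). (\<forall>a\<in>Ob (opp I). obj F a = X a) \<and> (\<forall>f\<in>Ar (opp I). act F f = \<phi> f)"
      if "\<And>a. a \<in> Ob (opp I) \<Longrightarrow> X a \<in> Ob (opp C)"
        "\<And>f a b. f \<in> hom (opp I) a b \<Longrightarrow> \<phi> f \<in> hom (opp C) (X a) (X b)"
        "\<And>a. a \<in> Ob (opp I) \<Longrightarrow> \<phi> (Ide (opp I) a) = Ide (opp C) (X a)"
        "\<And>f g a b c. f \<in> hom (opp I) a b \<Longrightarrow> g \<in> hom (opp I) b c
           \<Longrightarrow> \<phi> (g \<odot>\<^bsub>opp I\<^esub> f) = \<phi> g \<odot>\<^bsub>opp C\<^esub> \<phi> f" for X \<phi>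
      using functor_exists[of X \<phi>] that by simp
    show "\<exists>t\<in>hom (opp D) F G. \<forall>a\<in>Ob (opp I). cmp t a = \<tau> a"
      if that: "F \<in> Ob (opp D)" "G \<in> Ob (opp D)"
        "\<And>a. a \<in> Ob (opp I) \<Longrightarrow> \<tau> a \<in> hom (opp C) (obj F a) (obj G a)"
        and nat: "\<And>f a b. f \<in> hom (opp I) a b
           \<Longrightarrow> \<tau> b \<odot>\<^bsub>opp C\<^esub> act F f = act G f \<odot>\<^bsub>opp C\<^esub> \<tau> a" for F G \<tau>
      unfolding opp_simps hom_opp
    proof (rule transformation_exists)
      show "\<tau> b \<odot>\<^bsub>C\<^esub> act G f = act F f \<odot>\<^bsub>C\<^esub> \<tau> a" if "f \<in> hom I a b" for f a b
        using nat[of f b a] that by simp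
    qed (use that in auto)
  qed (auto simp: obj_Ob act_hom act_ide act_comp cmp_hom cmp_natural cmp_comp cmp_ide
         intro: transformation_eqI)
qed

definition eval_at :: "'i \<Rightarrow> ('k \<times> 'e \<times> 'k \<times> 'e) set \<Rightarrow> ('k \<times> 'm \<times> 'k \<times> 'm) set" where
  "eval_at a E = (\<lambda>(s, f, t, g). (s, cmp f a, t, cmp g a)) ` E"

lemma eval_at_simps [simp]:
  "eval_at a {} = {}"
  "eval_at a (insert (s, f, t, g) E) = insert (s, cmp f a, t, cmp g a) (eval_at a E)"
  by (simp_all add: eval_at_def)

lemma finite_eval_at: "finite E \<Longrightarrow> finite (eval_at a E)"
  by (simp add: eval_at_def)

lemma eq_system_eval:
  assumes E: "eq_system D K X E" and a: "a \<in> Ob I"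
  shows "eq_system C K (\<lambda>k. obj (X k) a) (eval_at a E)"
  unfolding eq_system_def
proof (intro conjI ballI)
  show "obj (X k) a \<in> Ob C" if "k \<in> K" for k
    using E a that obj_Ob unfolding eq_system_def by blast
  fix e assume "e \<in> eval_at a E"
  then obtain s f t g where e: "e = (s, cmp f a, t, cmp g a)" and E': "(s, f, t, g) \<in> E"
    unfolding eval_at_def by auto
  obtain y where "s \<in> K" "t \<in> K" "f \<in> hom D (X s) y" "g \<in> hom D (X t) y"
    using E E' by (auto elim: eq_systemD)
  then show "case e of (s, f, t, g) \<Rightarrow> s \<in> K \<and> t \<in> K \<and>
      (\<exists>y. f \<in> hom C (obj (X s) a) y \<and> g \<in> hom C (obj (X t) a) y)"
    unfolding e using cmp_hom[OF _ a] by blast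
qed

lemma solution_pointwise:
  assumes E: "eq_system D K X E"
  shows "solution D K X E M \<mu> \<longleftrightarrow> M \<in> Ob D \<and> (\<forall>k \<in> K. \<mu> k \<in> hom D M (X k)) \<and>
    (\<forall>a \<in> Ob I. solution C K (\<lambda>k. obj (X k) a) (eval_at a E) (obj M a) (\<lambda>k. cmp (\<mu> k) a))"
proof (cases "M \<in> Ob D \<and> (\<forall>k \<in> K. \<mu> k \<in> hom D M (X k))")
  case True
  have eq: "f \<odot>\<^bsub>D\<^esub> \<mu> s = g \<odot>\<^bsub>D\<^esub> \<mu> t \<longleftrightarrow>
      (\<forall>a \<in> Ob I. cmp f a \<odot>\<^bsub>C\<^esub> cmp (\<mu> s) a = cmp g a \<odot>\<^bsub>C\<^esub> cmp (\<mu> t) a)"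
    if e: "(s, f, t, g) \<in> E" for s f t g
  proof -
    obtain y where y: "s \<in> K" "t \<in> K" "f \<in> hom D (X s) y" "g \<in> hom D (X t) y"
      using E e by (auto elim: eq_systemD)
    then have h: "f \<odot>\<^bsub>D\<^esub> \<mu> s \<in> hom D M y" "g \<odot>\<^bsub>D\<^esub> \<mu> t \<in> hom D M y"
      using True D.comp_in_hom by blast+
    have "cmp (f \<odot>\<^bsub>D\<^esub> \<mu> s) a = cmp f a \<odot>\<^bsub>C\<^esub> cmp (\<mu> s) a"
      "cmp (g \<odot>\<^bsub>D\<^esub> \<mu> t) a = cmp g a \<odot>\<^bsub>C\<^esub> cmp (\<mu> t) a" if "a \<in> Ob I" for a
      using True y cmp_comp that by blast+
    then show ?thesis using transformation_eqI[OF h] by metis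
  qed
  have "obj M a \<in> Ob C" "k \<in> K \<Longrightarrow> cmp (\<mu> k) a \<in> hom C (obj M a) (obj (X k) a)"
    if "a \<in> Ob I" for a k
    using that True obj_Ob cmp_hom by blast+
  then show ?thesis
    using True eq unfolding solution_def eval_at_def by fastforce
qed (auto simp: solution_def)

text \<open>The comparison arrows at the objects of \<open>I\<close> are natural because universal solutions are
  tested by their projections.\<close>

lemma universal_if_pointwise:
  assumes E: "eq_system D K X E" and L: "L \<in> Ob D" and \<pi>: "\<And>k. k \<in> K \<Longrightarrow> \<pi> k \<in> hom D L (X k)"
    and pw: "\<And>a. a \<in> Ob I \<Longrightarrow> universal_solution C K (\<lambda>k. obj (X k) a) (eval_at a E) (obj L a)
                     (\<lambda>k. cmp (\<pi> k) a)"
  shows "universal_solution D K X E L \<pi>"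
  unfolding universal_solution_def
proof (intro conjI allI impI)
  show "solution D K X E L \<pi>"
    unfolding solution_pointwise[OF E] using L \<pi> pw unfolding universal_solution_def by blast
  fix M \<mu> assume \<mu>: "solution D K X E M \<mu>"
  then have M: "M \<in> Ob D" and \<mu>_hom: "\<And>k. k \<in> K \<Longrightarrow> \<mu> k \<in> hom D M (X k)"
    unfolding solution_def by blast+
  have "\<exists>u. u \<in> hom C (obj M a) (obj L a) \<and> (\<forall>k \<in> K. cmp (\<pi> k) a \<odot>\<^bsub>C\<^esub> u = cmp (\<mu> k) a)"
    if a: "a \<in> Ob I" for a
    using universal_factor[OF pw[OF a]] \<mu> a unfolding solution_pointwise[OF E] by metis
  then obtain \<tau> where \<tau>: "\<And>a. a \<in> Ob I \<Longrightarrow> \<tau> a \<in> hom C (obj M a) (obj L a)"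
    and \<pi>\<tau>: "\<And>a k. a \<in> Ob I \<Longrightarrow> k \<in> K \<Longrightarrow> cmp (\<pi> k) a \<odot>\<^bsub>C\<^esub> \<tau> a = cmp (\<mu> k) a"
    by metis
  have nat: "\<tau> b \<odot>\<^bsub>C\<^esub> act M f = act L f \<odot>\<^bsub>C\<^esub> \<tau> a" if f: "f \<in> hom I a b" for f a b
  proof (rule C.universal_eqI[OF eq_system_eval[OF E] pw])
    show b: "b \<in> Ob I" "b \<in> Ob I" using I.hom_Ob f by blast+
    have a: "a \<in> Ob I" using I.hom_Ob f by blast
    note af = act_hom[OF M f] act_hom[OF L f]
    show "\<tau> b \<odot>\<^bsub>C\<^esub> act M f \<in> hom C (obj M a) (obj L b)"
      "act L f \<odot>\<^bsub>C\<^esub> \<tau> a \<in> hom C (obj M a) (obj L b)"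
      using C.comp_in_hom af \<tau> a b by blast+
    fix k assume k: "k \<in> K"
    have Xk: "act (X k) f \<in> hom C (obj (X k) a) (obj (X k) b)"
      using act_hom[OF _ f] E k unfolding eq_system_def by blast
    have "cmp (\<pi> k) b \<odot>\<^bsub>C\<^esub> (\<tau> b \<odot>\<^bsub>C\<^esub> act M f) = cmp (\<mu> k) b \<odot>\<^bsub>C\<^esub> act M f"
      using C.comp_assoc[OF af(1) \<tau> cmp_hom[OF \<pi>[OF k]]] b \<pi>\<tau> k by metis
    also have "\<dots> = act (X k) f \<odot>\<^bsub>C\<^esub> (cmp (\<pi> k) a \<odot>\<^bsub>C\<^esub> \<tau> a)"
      using cmp_natural[OF \<mu>_hom[OF k] f] \<pi>\<tau> a k by simp
    also have "\<dots> = (cmp (\<pi> k) b \<odot>\<^bsub>C\<^esub> act L f) \<odot>\<^bsub>C\<^esub> \<tau> a"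
      using C.comp_assoc[OF \<tau>[OF a] cmp_hom[OF \<pi>[OF k] a] Xk] cmp_natural[OF \<pi>[OF k] f] by metis
    also have "\<dots> = cmp (\<pi> k) b \<odot>\<^bsub>C\<^esub> (act L f \<odot>\<^bsub>C\<^esub> \<tau> a)"
      using C.comp_assoc[OF \<tau>[OF a] af(2) cmp_hom[OF \<pi>[OF k] b(1)]] .
    finally show "cmp (\<pi> k) b \<odot>\<^bsub>C\<^esub> (\<tau> b \<odot>\<^bsub>C\<^esub> act M f) = \<dots>" .
  qed
  obtain u where u: "u \<in> hom D M L" "\<And>a. a \<in> Ob I \<Longrightarrow> cmp u a = \<tau> a"
    using transformation_exists[OF M L \<tau> nat] by blast
  show "\<exists>!u. u \<in> hom D M L \<and> (\<forall>k \<in> K. \<pi> k \<odot>\<^bsub>D\<^esub> u = \<mu> k)"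
  proof (intro ex1I[of _ u] conjI ballI)
    show "\<pi> k \<odot>\<^bsub>D\<^esub> u = \<mu> k" if k: "k \<in> K" for k
      by (rule transformation_eqI[OF D.comp_in_hom[OF u(1) \<pi>[OF k]] \<mu>_hom[OF k]])
        (simp add: cmp_comp[OF u(1) \<pi>[OF k]] u(2) \<pi>\<tau> k)
    fix v assume v: "v \<in> hom D M L \<and> (\<forall>k \<in> K. \<pi> k \<odot>\<^bsub>D\<^esub> v = \<mu> k)"
    show "v = u"
    proof (rule transformation_eqI[of _ M L])
      fix a assume a: "a \<in> Ob I"
      show "cmp v a = cmp u a"
      proof (rule C.universal_eqI[OF eq_system_eval[OF E a] pw[OF a]])
        show "cmp v a \<in> hom C (obj M a) (obj L a)" "cmp u a \<in> hom C (obj M a) (obj L a)"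
          using v u a cmp_hom by blast+
        show "cmp (\<pi> k) a \<odot>\<^bsub>C\<^esub> cmp v a = cmp (\<pi> k) a \<odot>\<^bsub>C\<^esub> cmp u a" if k: "k \<in> K" for k
          using cmp_comp[OF _ \<pi>[OF k] a] v u \<pi>\<tau> a k by metis
      qed
    qed (use u v in blast)+
  qed (use u in blast)
qed

text \<open>Universal solutions chosen at each object of \<open>I\<close> assemble to a functor: an arrow of \<open>I\<close> acts by the
  arrow that universality at its codomain provides. Uniqueness of that arrow yields functoriality.\<close>

lemma pointwise_solution_exists:
  assumes E: "eq_system D K X E"
    and pw: "\<And>a. a \<in> Ob I \<Longrightarrow> solvable C K (\<lambda>k. obj (X k) a) (eval_at a E)"
  obtains L \<pi> where "L \<in> Ob D" "\<And>k. k \<in> K \<Longrightarrow> \<pi> k \<in> hom D L (X k)"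
    "\<And>a. a \<in> Ob I \<Longrightarrow> universal_solution C K (\<lambda>k. obj (X k) a) (eval_at a E) (obj L a)
                     (\<lambda>k. cmp (\<pi> k) a)"
proof -
  obtain Y \<rho> where Y: "\<And>a. a \<in> Ob I
      \<Longrightarrow> universal_solution C K (\<lambda>k. obj (X k) a) (eval_at a E) (Y a) (\<rho> a)"
    using pw unfolding solvable_def by metis
  have Y_Ob: "Y a \<in> Ob C" and \<rho>: "k \<in> K \<Longrightarrow> \<rho> a k \<in> hom C (Y a) (obj (X k) a)"
    if "a \<in> Ob I" for a k
    using Y[OF that] unfolding universal_solution_def solution_def by blast+
  have XO: "k \<in> K \<Longrightarrow> X k \<in> Ob D" for k using E unfolding eq_system_def by blast
  have "\<exists>u. u \<in> hom C (Y a) (Y b) \<and> (\<forall>k\<in>K. \<rho> b k \<odot>\<^bsub>C\<^esub> u = act (X k) f \<odot>\<^bsub>C\<^esub> \<rho> a k)"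
    if f: "f \<in> hom I a b" for a b f
  proof -
    have ab: "a \<in> Ob I" "b \<in> Ob I" using f I.hom_Ob by blast+
    have "solution C K (\<lambda>k. obj (X k) b) (eval_at b E) (Y a) (\<lambda>k. act (X k) f \<odot>\<^bsub>C\<^esub> \<rho> a k)"
      unfolding solution_def
    proof (intro conjI ballI)
      show "act (X k) f \<odot>\<^bsub>C\<^esub> \<rho> a k \<in> hom C (Y a) (obj (X k) b)" if "k \<in> K" for k
        using \<rho>[OF ab(1) that] act_hom[OF XO[OF that] f] C.comp_in_hom by blast
      fix e assume "e \<in> eval_at b E"
      then obtain s x t y where e: "e = (s, cmp x b, t, cmp y b)" and E': "(s, x, t, y) \<in> E"
        unfolding eval_at_def by auto
      obtain Z where Z: "s \<in> K" "t \<in> K" "x \<in> hom D (X s) Z" "y \<in> hom D (X t) Z"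
        using E E' by (auto elim: eq_systemD)
      have ZO: "Z \<in> Ob D" using Z D.hom_Ob by blast
      have eq: "cmp x a \<odot>\<^bsub>C\<^esub> \<rho> a s = cmp y a \<odot>\<^bsub>C\<^esub> \<rho> a t"
        using Y[OF ab(1)] E' unfolding universal_solution_def solution_def eval_at_def by fastforce
      have shift: "cmp z b \<odot>\<^bsub>C\<^esub> (act (X k) f \<odot>\<^bsub>C\<^esub> \<rho> a k) = act Z f \<odot>\<^bsub>C\<^esub> (cmp z a \<odot>\<^bsub>C\<^esub> \<rho> a k)"
        if "k \<in> K" "z \<in> hom D (X k) Z" for k z
        using C.comp_assoc[OF \<rho>[OF ab(1)] act_hom[OF XO f] cmp_hom[OF _ ab(2)]]
          C.comp_assoc[OF \<rho>[OF ab(1)] cmp_hom[OF _ ab(1)] act_hom[OF ZO f]]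
          cmp_natural[OF _ f] that by metis
      show "case e of (s, x, t, y) \<Rightarrow>
          x \<odot>\<^bsub>C\<^esub> (act (X s) f \<odot>\<^bsub>C\<^esub> \<rho> a s) = y \<odot>\<^bsub>C\<^esub> (act (X t) f \<odot>\<^bsub>C\<^esub> \<rho> a t)"
        using shift Z eq by (simp add: e)
    qed (use Y_Ob ab in blast)
    from universal_factor[OF Y[OF ab(2)] this] show ?thesis by metis
  qed
  \<comment> \<open>The action must be chosen for \<open>f\<close> alone; this is possible as \<open>f\<close> determines its domain and
    codomain.\<close>
  then have "\<exists>u. \<forall>a b. f \<in> hom I a b \<longrightarrow> u \<in> hom C (Y a) (Y b) \<and>
      (\<forall>k\<in>K. \<rho> b k \<odot>\<^bsub>C\<^esub> u = act (X k) f \<odot>\<^bsub>C\<^esub> \<rho> a k)" for f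
    by (metis homD(2,3))
  then obtain \<phi> where \<phi>: "\<And>f a b. f \<in> hom I a b \<Longrightarrow> \<phi> f \<in> hom C (Y a) (Y b)"
    and \<rho>\<phi>: "\<And>f a b k. f \<in> hom I a b \<Longrightarrow> k \<in> K
               \<Longrightarrow> \<rho> b k \<odot>\<^bsub>C\<^esub> \<phi> f = act (X k) f \<odot>\<^bsub>C\<^esub> \<rho> a k"
    by metis
  have ide: "\<phi> (Ide I a) = Ide C (Y a)" if a: "a \<in> Ob I" for a
  proof (rule C.universal_eqI[OF eq_system_eval[OF E a] Y[OF a]])
    note h = I.ide_in_hom[OF a]
    show "\<phi> (Ide I a) \<in> hom C (Y a) (Y a)" using \<phi>[OF h] .
    show "Ide C (Y a) \<in> hom C (Y a) (Y a)" using C.ide_in_hom Y_Ob a by blast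
    show "\<rho> a k \<odot>\<^bsub>C\<^esub> \<phi> (Ide I a) = \<rho> a k \<odot>\<^bsub>C\<^esub> Ide C (Y a)" if k: "k \<in> K" for k
      using \<rho>\<phi>[OF h k] act_ide[OF XO[OF k] a] C.comp_ide_left[OF \<rho>[OF a k]]
        C.comp_ide_right[OF \<rho>[OF a k]] by simp
  qed
  have comp: "\<phi> (g \<odot>\<^bsub>I\<^esub> f) = \<phi> g \<odot>\<^bsub>C\<^esub> \<phi> f" if f: "f \<in> hom I a b" and g: "g \<in> hom I b c" for f g a b c
  proof -
    have a: "a \<in> Ob I" and b: "b \<in> Ob I" and c: "c \<in> Ob I" using f g I.hom_Ob by blast+
    note gf = I.comp_in_hom[OF f g]
    show ?thesis
    proof (rule C.universal_eqI[OF eq_system_eval[OF E c] Y[OF c]])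
      show "\<phi> (g \<odot>\<^bsub>I\<^esub> f) \<in> hom C (Y a) (Y c)" using \<phi>[OF gf] .
      show "\<phi> g \<odot>\<^bsub>C\<^esub> \<phi> f \<in> hom C (Y a) (Y c)" using \<phi>[OF f] \<phi>[OF g] C.comp_in_hom by blast
      fix k assume k: "k \<in> K"
      have "\<rho> c k \<odot>\<^bsub>C\<^esub> (\<phi> g \<odot>\<^bsub>C\<^esub> \<phi> f) = (act (X k) g \<odot>\<^bsub>C\<^esub> \<rho> b k) \<odot>\<^bsub>C\<^esub> \<phi> f"
        using C.comp_assoc[OF \<phi>[OF f] \<phi>[OF g] \<rho>[OF c k]] \<rho>\<phi>[OF g k] by simp
      also have "\<dots> = act (X k) g \<odot>\<^bsub>C\<^esub> (act (X k) f \<odot>\<^bsub>C\<^esub> \<rho> a k)"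
        using C.comp_assoc[OF \<phi>[OF f] \<rho>[OF b k] act_hom[OF XO[OF k] g]] \<rho>\<phi>[OF f k] by simp
      also have "\<dots> = act (X k) (g \<odot>\<^bsub>I\<^esub> f) \<odot>\<^bsub>C\<^esub> \<rho> a k"
        using C.comp_assoc[OF \<rho>[OF a k] act_hom[OF XO[OF k] f] act_hom[OF XO[OF k] g]]
          act_comp[OF XO[OF k] f g] by simp
      finally show "\<rho> c k \<odot>\<^bsub>C\<^esub> \<phi> (g \<odot>\<^bsub>I\<^esub> f) = \<rho> c k \<odot>\<^bsub>C\<^esub> (\<phi> g \<odot>\<^bsub>C\<^esub> \<phi> f)"
        using \<rho>\<phi>[OF gf k] by simp
    qed
  qed
  obtain L where L: "L \<in> Ob D" and obj_L: "\<And>a. a \<in> Ob I \<Longrightarrow> obj L a = Y a"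
    and act_L: "\<And>f. f \<in> Ar I \<Longrightarrow> act L f = \<phi> f"
  proof -
    have "\<exists>F\<in>Ob D. (\<forall>a\<in>Ob I. obj F a = Y a) \<and> (\<forall>f\<in>Ar I. act F f = \<phi> f)"
      by (rule functor_exists) (fact Y_Ob \<phi> ide comp)+
    then show thesis using that by blast
  qed
  have "\<exists>t. t \<in> hom D L (X k) \<and> (\<forall>a \<in> Ob I. cmp t a = \<rho> a k)" if k: "k \<in> K" for k
  proof -
    have "\<exists>t \<in> hom D L (X k). \<forall>a \<in> Ob I. cmp t a = (\<lambda>a. \<rho> a k) a"
    proof (rule transformation_exists[OF L XO[OF k]])
      show "\<rho> a k \<in> hom C (obj L a) (obj (X k) a)" if "a \<in> Ob I" for a
        using \<rho> that k obj_L by simp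
      show "\<rho> b k \<odot>\<^bsub>C\<^esub> act L f = act (X k) f \<odot>\<^bsub>C\<^esub> \<rho> a k" if "f \<in> hom I a b" for f a b
        using \<rho>\<phi>[OF that k] act_L homD(1)[OF that] by simp
    qed
    then show ?thesis by blast
  qed
  then obtain \<pi> where \<pi>: "\<And>k. k \<in> K \<Longrightarrow> \<pi> k \<in> hom D L (X k)"
    and cmp_\<pi>: "\<And>k a. k \<in> K \<Longrightarrow> a \<in> Ob I \<Longrightarrow> cmp (\<pi> k) a = \<rho> a k"
    by metis
  have "universal_solution C K (\<lambda>k. obj (X k) a) (eval_at a E) (obj L a) (\<lambda>k. cmp (\<pi> k) a)"
    if a: "a \<in> Ob I" for a
    \<comment> \<open>The components of \<open>\<pi>\<close> agree with \<open>\<rho>\<close> on \<open>K\<close> only, so the two families are compared along an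
      identity.\<close>
  proof (rule C.universal_iso[OF eq_system_eval[OF E a] Y[OF a]])
    have i: "Ide C (Y a) \<in> hom C (Y a) (Y a)" using C.ide_in_hom Y_Ob a by blast
    then show "Ide C (Y a) \<in> hom C (obj L a) (Y a)" using obj_L[OF a] by simp
    show "iso C (Ide C (Y a))" using C.isoI[OF i i] C.comp_ide_left[OF i] by blast
    show "\<rho> a k \<odot>\<^bsub>C\<^esub> Ide C (Y a) = cmp (\<pi> k) a" if "k \<in> K" for k
      using C.comp_ide_right[OF \<rho>[OF a that]] cmp_\<pi>[OF that a] by simp
  qed
  then show thesis using that L \<pi> by blast
qed

theorem solvable_if_pointwise:
  assumes E: "eq_system D K X E"
    and pw: "\<And>a. a \<in> Ob I \<Longrightarrow> solvable C K (\<lambda>k. obj (X k) a) (eval_at a E)"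
  shows "solvable D K X E"
  using pointwise_solution_exists[OF E pw] universal_if_pointwise[OF E]
  unfolding solvable_def by metis

lemma iso_cmp:
  assumes "iso D t" "t \<in> hom D F G" "a \<in> Ob I"
  shows "iso C (cmp t a)"
proof -
  obtain s where s: "s \<in> hom D G F" "s \<odot>\<^bsub>D\<^esub> t = Ide D F" "t \<odot>\<^bsub>D\<^esub> s = Ide D G"
    using D.isoE[OF assms(1,2)] by blast
  have FG: "F \<in> Ob D" "G \<in> Ob D" using D.hom_Ob assms(2) by blast+
  show ?thesis
    using C.isoI[OF cmp_hom[OF assms(2,3)] cmp_hom[OF s(1) assms(3)]] s(2,3)
      cmp_comp[OF assms(2) s(1) assms(3)] cmp_comp[OF s(1) assms(2,3)] cmp_ide FG assms(3) by metis
qed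

text \<open>Evaluation preserves a universal solution because the one constructed pointwise is isomorphic to
  it.\<close>

theorem universal_pointwise:
  assumes E: "eq_system D K X E"
    and pw: "\<And>a. a \<in> Ob I \<Longrightarrow> solvable C K (\<lambda>k. obj (X k) a) (eval_at a E)"
    and U: "universal_solution D K X E M \<mu>" and a: "a \<in> Ob I"
  shows "universal_solution C K (\<lambda>k. obj (X k) a) (eval_at a E) (obj M a) (\<lambda>k. cmp (\<mu> k) a)"
proof -
  obtain L \<pi> where L: "L \<in> Ob D" "\<And>k. k \<in> K \<Longrightarrow> \<pi> k \<in> hom D L (X k)"
    "\<And>a. a \<in> Ob I \<Longrightarrow> universal_solution C K (\<lambda>k. obj (X k) a) (eval_at a E) (obj L a)
                     (\<lambda>k. cmp (\<pi> k) a)"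
    using pointwise_solution_exists[OF E pw] by blast
  obtain u where u: "u \<in> hom D M L" "iso D u" "\<And>k. k \<in> K \<Longrightarrow> \<pi> k \<odot>\<^bsub>D\<^esub> u = \<mu> k"
    using D.universal_unique[OF E U universal_if_pointwise[OF E L]] by blast
  show ?thesis
  proof (rule C.universal_iso[OF eq_system_eval[OF E a] L(3)[OF a]])
    show "cmp u a \<in> hom C (obj M a) (obj L a)" using cmp_hom u a by blast
    show "iso C (cmp u a)" using iso_cmp u a by blast
    show "cmp (\<pi> k) a \<odot>\<^bsub>C\<^esub> cmp u a = cmp (\<mu> k) a" if "k \<in> K" for k
      using cmp_comp[OF u(1) L(2)[OF that] a] u(3)[OF that] by simp
  qed
qed

corollary universal_iff_pointwise:
  assumes E: "eq_system D K X E"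
    and pw: "\<And>a. a \<in> Ob I \<Longrightarrow> solvable C K (\<lambda>k. obj (X k) a) (eval_at a E)"
    and L: "L \<in> Ob D" and \<pi>: "\<And>k. k \<in> K \<Longrightarrow> \<pi> k \<in> hom D L (X k)"
  shows "universal_solution D K X E L \<pi> \<longleftrightarrow> (\<forall>a \<in> Ob I.
    universal_solution C K (\<lambda>k. obj (X k) a) (eval_at a E) (obj L a) (\<lambda>k. cmp (\<pi> k) a))"
  using universal_pointwise[OF E pw] universal_if_pointwise[OF E L \<pi>] by blast

end

section \<open>Finite limits as universal solutions\<close>

text \<open>An arrow \<open>f\<close> of the index category contributes the commutativity of its triangle in a cone. The
  identity on the right-hand side only brings that condition into the form of an equation.\<close>

definition cone_equations ::
    "('i, 'j) cat \<Rightarrow> ('o, 'm) cat \<Rightarrow> ('i, 'j, 'o, 'm) ftr \<Rightarrow> ('i \<times> 'm \<times> 'i \<times> 'm) set" where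
  "cone_equations J C F =
     (\<lambda>f. (Dom J f, FAr F f, Cod J f, Ide C (FOb F (Cod J f)))) ` Ar J"

context category
begin

lemma eq_system_cone_equations:
  assumes "category J" "is_functor J C F"
  shows "eq_system C (Ob J) (FOb F) (cone_equations J C F)"
proof -
  interpret J: category J by fact
  have "FOb F a \<in> Ob C" if "a \<in> Ob J" for a
    using assms(2) that unfolding is_functor_def by blast
  moreover have "FAr F f \<in> hom C (FOb F (Dom J f)) (FOb F (Cod J f))" if "f \<in> Ar J" for f
    using assms(2) that unfolding is_functor_def by blast
  ultimately show ?thesis
    using J.dom_in_Ob J.cod_in_Ob ide_in_hom unfolding eq_system_def cone_equations_def by fastforce
qed

lemma cone_iff_solution:
  assumes "category J" "is_functor J C F"
  shows "cone J C F L \<pi> \<longleftrightarrow> solution C (Ob J) (FOb F) (cone_equations J C F) L \<pi>"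
proof -
  interpret J: category J by fact
  have "Ide C (FOb F (Cod J f)) \<odot> \<pi> (Cod J f) = \<pi> (Cod J f)"
    if "\<forall>a \<in> Ob J. \<pi> a \<in> hom C L (FOb F a)" "f \<in> Ar J" for f
    using that J.cod_in_Ob comp_ide_left by blast
  then show ?thesis
    unfolding cone_def solution_def cone_equations_def by auto
qed

lemma limit_cone_iff_universal:
  assumes "category J" "is_functor J C F"
  shows "limit_cone J C F L \<pi> \<longleftrightarrow> universal_solution C (Ob J) (FOb F) (cone_equations J C F) L \<pi>"
  unfolding limit_cone_def universal_solution_def cone_iff_solution[OF assms] ..

end

text \<open>A finite system with \<open>m\<close> equations and unknowns below \<open>n\<close> is a diagram on the following index category: the unknowns and the equations
  are the objects, and besides identities there are only the two sides of each equation, arrows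
  into the object of that equation. Non-identity arrows are therefore never composable. Equation \<open>i\<close>
  is the object \<open>n + i\<close>, its sides are the arrows \<open>n + m + i\<close> and \<open>n + m + m + i\<close>, and an identity has the
  same number as its object.\<close>

definition equations_cat :: "nat set \<Rightarrow> nat \<Rightarrow> nat \<Rightarrow> (nat \<Rightarrow> nat) \<Rightarrow> (nat \<Rightarrow> nat) \<Rightarrow> (nat, nat) cat"
  where
  "equations_cat K n m s t =
     \<lparr> Ob = K \<union> {n..<n + m},
       Ar = K \<union> {n..<n + m} \<union> {n + m..<n + m + m + m},
       Dom = (\<lambda>x. if x < n + m then x
                  else if x < n + m + m then s (x - (n + m)) else t (x - (n + m + m))),
       Cod = (\<lambda>x. if x < n + m then x else if x < n + m + m then x - m else x - (m + m)),
       Ide = (\<lambda>x. x),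
       Comp = (\<lambda>g f. if g < n + m then f else g) \<rparr>"

lemma category_equations_cat:
  assumes K: "K \<subseteq> {..<n}" and st: "\<And>i. i < m \<Longrightarrow> s i \<in> K \<and> t i \<in> K"
  shows "category (equations_cat K n m s t)" (is "category ?J")
proof -
  have st_less: "s i < n" "t i < n" if "i < m" for i using K st that by blast+
  have K_less: "x < n" if "x \<in> K" for x using K that by blast
  have left: "g < n + m \<Longrightarrow> g = b \<and> b = c" and right: "\<not> g < n + m \<Longrightarrow> b < n"
    if "g \<in> hom ?J b c" for g b c
    using that st_less unfolding hom_def equations_cat_def
    by (auto split: if_splits dest: K_less)
  have idle: "f < n + m \<and> f = a \<and> f = b" if "f \<in> hom ?J a b" "b < n" for f a b
    using that st_less K_less unfolding hom_def equations_cat_def by (auto split: if_splits)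
  have Comp: "g \<odot>\<^bsub>?J\<^esub> f = (if g < n + m then f else g)" for g f
    by (simp add: equations_cat_def)
  show ?thesis
  proof
    fix f assume f: "f \<in> Ar ?J"
    then consider "f \<in> Ob ?J" "f < n + m" | "n + m \<le> f" "f < n + m + m"
      | "n + m + m \<le> f" "f < n + m + m + m"
      unfolding equations_cat_def using K_less by fastforce
    then show "Dom ?J f \<in> Ob ?J" "Cod ?J f \<in> Ob ?J"
      using st[of "f - (n + m)"] st[of "f - (n + m + m)"]
      by (cases; force simp: equations_cat_def)+
  next
    show "Ide ?J a \<in> hom ?J a a" if "a \<in> Ob ?J" for a
      using that unfolding hom_def equations_cat_def by (auto dest: K_less)
    show "g \<odot>\<^bsub>?J\<^esub> f \<in> hom ?J a c" if f: "f \<in> hom ?J a b" and g: "g \<in> hom ?J b c" for f g a b c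
    proof (cases "g < n + m")
      case True
      then show ?thesis using f left[OF g True] Comp by simp
    next
      case False
      then have "a = b" using idle[OF f right[OF g False]] by blast
      then show ?thesis using g False Comp by simp
    qed
    show "Ide ?J b \<odot>\<^bsub>?J\<^esub> f = f" if f: "f \<in> hom ?J a b" for f a b
    proof (cases "f < n + m")
      case True
      then show ?thesis using left[OF f True] by (simp add: equations_cat_def)
    next
      case False
      have "b < n + m" using f st_less unfolding hom_def equations_cat_def
        by (auto split: if_splits dest: K_less)
      then show ?thesis by (simp add: equations_cat_def)
    qed
    show "f \<odot>\<^bsub>?J\<^esub> Ide ?J a = f" if f: "f \<in> hom ?J a b" for f a b
    proof (cases "f < n + m")
      case True
      then show ?thesis using left[OF f True] by (simp add: equations_cat_def)
    next
      case False
      then show ?thesis using right[OF f False] by (simp add: equations_cat_def)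
    qed
    show "(h \<odot>\<^bsub>?J\<^esub> g) \<odot>\<^bsub>?J\<^esub> f = h \<odot>\<^bsub>?J\<^esub> (g \<odot>\<^bsub>?J\<^esub> f)"
      if "f \<in> hom ?J a b" "g \<in> hom ?J b c" "h \<in> hom ?J c d" for f g h a b c d
      using left[OF that(3)] right[OF that(3)] idle[OF that(2)] Comp by auto
  qed
qed

text \<open>A cone over the diagram of a system is a solution extended, at the object of each equation, by the
  common value of the two sides. Hence a limit cone restricts to a universal solution.\<close>

theorem (in category) finite_systems_solvable:
  fixes K :: "nat set"
  assumes fc: "finitely_complete C" and "finite K" "finite E" and E: "eq_system C K X E"
  shows "solvable C K X E"
proof -
  define m where "m = card E"
  obtain h where h: "bij_betw h {0..<m} E"
    using ex_bij_betw_nat_finite[OF \<open>finite E\<close>] m_def by blast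
  obtain n where Kn: "K \<subseteq> {..<n}"
    using \<open>finite K\<close> unfolding finite_nat_set_iff_bounded by blast
  define s f t g where "s i = fst (h i)" and "f i = fst (snd (h i))"
    and "t i = fst (snd (snd (h i)))" and "g i = snd (snd (snd (h i)))" for i
  have E_eq: "E = (\<lambda>i. (s i, f i, t i, g i)) ` {0..<m}"
    using bij_betw_imp_surj_on[OF h] by (simp add: s_def f_def t_def g_def)
  define y where "y i = Cod C (f i)" for i
  have sys: "s i \<in> K \<and> t i \<in> K \<and> f i \<in> hom C (X (s i)) (y i) \<and> g i \<in> hom C (X (t i)) (y i)"
    if "i < m" for i
  proof -
    have "(s i, f i, t i, g i) \<in> E" using E_eq that by auto
    from eq_systemD[OF E this] show ?thesis unfolding y_def by (metis homD(3))
  qed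
  have K_less: "x < n" if "x \<in> K" for x using Kn that by blast
  have st_less: "s i < n" "t i < n" if "i < m" for i using sys[OF that] K_less by blast+
  let ?J = "equations_cat K n m s t"
  define W where "W v = (if v \<in> K then X v else y (v - n))" for v
  define A where "A x = (if x < n + m then Ide C (W x)
    else if x < n + m + m then f (x - (n + m)) else g (x - (n + m + m)))" for x
  define F where "F = \<lparr> FOb = restrict W (Ob ?J), FAr = restrict A (Ar ?J) \<rparr>"
  have J: "category ?J" by (rule category_equations_cat[OF Kn]) (use sys in blast)
  interpret J: category ?J by (rule J)
  have W_Ob: "W v \<in> Ob C" if "v \<in> Ob ?J" for v
  proof (cases "v \<in> K")
    case True then show ?thesis using E unfolding W_def eq_system_def by auto
  next
    case False
    then have "v - n < m" using that by (auto simp: equations_cat_def)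
    then show ?thesis using sys hom_Ob False unfolding W_def by fastforce
  qed
  have W_vertex: "W (n + i) = y i" "W (n + m + i - m) = y i" "W (n + m + m + i - (m + m)) = y i" for i
    using Kn by (auto simp: W_def algebra_simps)
  have arrows: "x \<in> Ob ?J \<and> x < n + m \<or> (\<exists>i<m. x = n + m + i) \<or> (\<exists>i<m. x = n + m + m + i)"
    if "x \<in> Ar ?J" for x
  proof -
    consider "x < n + m" | "n + m \<le> x" "x < n + m + m" | "n + m + m \<le> x" by linarith
    then show ?thesis
    proof cases
      case 1 then show ?thesis using that by (auto simp: equations_cat_def)
    next
      case 2 then show ?thesis by (intro disjI2 disjI1 exI[of _ "x - (n + m)"]) auto
    next
      case 3
      then have "x < n + m + m + m" using that K_less by (fastforce simp: equations_cat_def)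
      then show ?thesis using 3 by (intro disjI2 exI[of _ "x - (n + m + m)"]) auto
    qed
  qed
  have ide_J: "Dom ?J x = x" "Cod ?J x = x" "A x = Ide C (W x)" if "x < n + m" for x
    using that by (auto simp: equations_cat_def A_def)
  have left_J: "n + m + i \<in> Ar ?J" "Dom ?J (n + m + i) = s i" "Cod ?J (n + m + i) = n + i"
    "A (n + m + i) = f i" if "i < m" for i
    using that by (auto simp: equations_cat_def A_def)
  have right_J: "n + m + m + i \<in> Ar ?J" "Dom ?J (n + m + m + i) = t i"
    "Cod ?J (n + m + m + i) = n + i" "A (n + m + m + i) = g i" if "i < m" for i
    using that by (auto simp: equations_cat_def A_def)
  have W_K: "W k = X k" if "k \<in> K" for k using that by (simp add: W_def)
  have A_hom: "A x \<in> hom C (W (Dom ?J x)) (W (Cod ?J x))" if x: "x \<in> Ar ?J" for x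
    using arrows[OF x]
  proof (elim disjE exE conjE)
    assume "x \<in> Ob ?J" "x < n + m"
    then show ?thesis using ide_J W_Ob ide_in_hom by simp
  qed (use left_J right_J sys W_K W_vertex in auto)
  have F: "is_functor ?J C F"
    unfolding is_functor_def
  proof (intro conjI ballI impI)
    show "FOb F \<in> Ob ?J \<rightarrow>\<^sub>E Ob C" using W_Ob by (simp add: F_def)
    show "FAr F \<in> Ar ?J \<rightarrow>\<^sub>E Ar C" using A_hom by (auto simp: F_def dest: homD)
    show "FAr F x \<in> hom C (FOb F (Dom ?J x)) (FOb F (Cod ?J x))" if "x \<in> Ar ?J" for x
      using A_hom[OF that] J.dom_in_Ob J.cod_in_Ob that by (simp add: F_def)
    show "FAr F (Ide ?J a) = Ide C (FOb F a)" if "a \<in> Ob ?J" for a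
      using that Kn by (auto simp: F_def A_def equations_cat_def)
    fix x z assume x: "x \<in> Ar ?J" and z: "z \<in> Ar ?J" and zx: "Dom ?J z = Cod ?J x"
    have zx_Ar: "z \<odot>\<^bsub>?J\<^esub> x \<in> Ar ?J"
      using J.comp_in_hom[OF hom_self[OF x]] hom_self[OF z] zx by (metis homD(1))
    have "A (z \<odot>\<^bsub>?J\<^esub> x) = A z \<odot> A x"
    proof (cases "z < n + m")
      case True
      then have "z \<odot>\<^bsub>?J\<^esub> x = x" by (simp add: equations_cat_def)
      moreover have "A z = Ide C (W (Cod ?J x))" using ide_J[OF True] zx by simp
      ultimately show ?thesis using comp_ide_left[OF A_hom[OF x]] by simp
    next
      case False
      then have "Dom ?J z < n" using arrows[OF z] left_J right_J st_less by auto
      then have "Cod ?J x < n" using zx by simp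
      then have x_ide: "x < n + m" using arrows[OF x] left_J right_J by auto
      then have "A x = Ide C (W (Dom ?J z))" using ide_J[OF x_ide] zx by simp
      moreover have "z \<odot>\<^bsub>?J\<^esub> x = z" using False by (simp add: equations_cat_def)
      ultimately show ?thesis using comp_ide_right[OF A_hom[OF z]] by simp
    qed
    then show "FAr F (z \<odot>\<^bsub>?J\<^esub> x) = FAr F z \<odot> FAr F x" using x z zx_Ar by (simp add: F_def)
  qed
  have "finite_cat ?J" using J \<open>finite K\<close> by (simp add: finite_cat_def equations_cat_def)
  then obtain L \<pi> where L: "limit_cone ?J C F L \<pi>"
    using fc F unfolding finitely_complete_def by blast
  have cone_iff: "cone ?J C F M \<mu> \<longleftrightarrow> solution C K X E M \<mu> \<and>
      (\<forall>i<m. \<mu> (n + i) = f i \<odot> \<mu> (s i))" for M \<mu>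
  proof
    assume c: "cone ?J C F M \<mu>"
    have tri: "A x \<odot> \<mu> (Dom ?J x) = \<mu> (Cod ?J x)" if "x \<in> Ar ?J" for x
      using c that unfolding cone_def F_def by auto
    have l: "\<mu> (n + i) = f i \<odot> \<mu> (s i)" and r: "\<mu> (n + i) = g i \<odot> \<mu> (t i)" if "i < m" for i
      using tri[OF left_J(1)[OF that]] tri[OF right_J(1)[OF that]] left_J[OF that] right_J[OF that]
      by simp_all
    have "\<mu> k \<in> hom C M (X k)" if k: "k \<in> K" for k
    proof -
      have "k \<in> Ob ?J" using k by (simp add: equations_cat_def)
      then have "\<mu> k \<in> hom C M (W k)" using c unfolding cone_def F_def by simp
      then show ?thesis using W_K[OF k] by simp
    qed
    moreover have "f i \<odot> \<mu> (s i) = g i \<odot> \<mu> (t i)" if "i < m" for i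
      using l[OF that] r[OF that] by simp
    ultimately have "solution C K X E M \<mu>"
      using c unfolding solution_def cone_def by (auto simp: E_eq)
    then show "solution C K X E M \<mu> \<and> (\<forall>i<m. \<mu> (n + i) = f i \<odot> \<mu> (s i))" using l by blast
  next
    assume \<mu>: "solution C K X E M \<mu> \<and> (\<forall>i<m. \<mu> (n + i) = f i \<odot> \<mu> (s i))"
    then have \<mu>_K: "\<mu> k \<in> hom C M (X k)" if "k \<in> K" for k
      using that unfolding solution_def by blast
    have eq: "f i \<odot> \<mu> (s i) = g i \<odot> \<mu> (t i)" if "i < m" for i
      using \<mu> that unfolding solution_def by (auto simp: E_eq)
    have \<mu>_hom: "\<mu> v \<in> hom C M (W v)" if v: "v \<in> Ob ?J" for v
    proof (cases "v \<in> K")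
      case True then show ?thesis using \<mu>_K W_K by simp
    next
      case False
      then obtain i where i: "i < m" "v = n + i"
        using v by (auto simp: equations_cat_def nat_le_iff_add)
      then have "\<mu> v = f i \<odot> \<mu> (s i)" using \<mu> by blast
      moreover have "f i \<odot> \<mu> (s i) \<in> hom C M (y i)"
        using sys[OF i(1)] \<mu>_K comp_in_hom by blast
      ultimately show ?thesis using i W_vertex by simp
    qed
    have "A x \<odot> \<mu> (Dom ?J x) = \<mu> (Cod ?J x)" if x: "x \<in> Ar ?J" for x
      using arrows[OF x]
    proof (elim disjE exE conjE)
      assume "x \<in> Ob ?J" "x < n + m"
      then show ?thesis using ide_J comp_ide_left[OF \<mu>_hom[of x]] by simp
    next
      fix i assume "i < m" "x = n + m + i"
      then show ?thesis using left_J[of i] \<mu> by metis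
    next
      fix i assume "i < m" "x = n + m + m + i"
      then show ?thesis using right_J[of i] eq[of i] \<mu> by metis
    qed
    then show "cone ?J C F M \<mu>"
      using \<mu> \<mu>_hom J.dom_in_Ob J.cod_in_Ob unfolding cone_def solution_def F_def by auto
  qed
  have L_cone: "cone ?J C F L \<pi>" using L unfolding limit_cone_def by blast
  have "universal_solution C K X E L \<pi>"
    unfolding universal_solution_def
  proof (intro conjI allI impI)
    show L_sol: "solution C K X E L \<pi>" using L_cone cone_iff by blast
    fix M \<mu> assume \<mu>: "solution C K X E M \<mu>"
    define \<mu>' where "\<mu>' v = (if v \<in> K then \<mu> v else f (v - n) \<odot> \<mu> (s (v - n)))" for v
    have "solution C K X E M \<mu>'"
      using \<mu> sys unfolding solution_def E_eq \<mu>'_def by auto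
    moreover have "\<mu>' (n + i) = f i \<odot> \<mu>' (s i)" if "i < m" for i
      using Kn sys[OF that] by (auto simp: \<mu>'_def)
    ultimately have "cone ?J C F M \<mu>'" unfolding cone_iff by blast
    then have ex1: "\<exists>!u. u \<in> hom C M L \<and> (\<forall>v \<in> Ob ?J. \<pi> v \<odot> u = \<mu>' v)"
      using L unfolding limit_cone_def by blast
    have "(\<forall>v \<in> Ob ?J. \<pi> v \<odot> u = \<mu>' v) \<longleftrightarrow> (\<forall>k \<in> K. \<pi> k \<odot> u = \<mu> k)" if u: "u \<in> hom C M L" for u
    proof
      assume K: "\<forall>k \<in> K. \<pi> k \<odot> u = \<mu> k"
      have "\<pi> (n + i) \<odot> u = f i \<odot> \<mu> (s i)" if i: "i < m" for i
      proof -
        have "\<pi> (s i) \<in> hom C L (X (s i))" using L_sol sys[OF i] unfolding solution_def by blast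
        then have "(f i \<odot> \<pi> (s i)) \<odot> u = f i \<odot> (\<pi> (s i) \<odot> u)"
          using comp_assoc[OF u] sys[OF i] by blast
        then show ?thesis using L_cone i sys[OF i] K unfolding cone_iff by simp
      qed
      then show "\<forall>v \<in> Ob ?J. \<pi> v \<odot> u = \<mu>' v"
        using K unfolding \<mu>'_def by (auto simp: equations_cat_def nat_le_iff_add)
    next
      assume v: "\<forall>v \<in> Ob ?J. \<pi> v \<odot> u = \<mu>' v"
      show "\<forall>k \<in> K. \<pi> k \<odot> u = \<mu> k"
      proof
        fix k assume k: "k \<in> K"
        then have "k \<in> Ob ?J" by (simp add: equations_cat_def)
        then show "\<pi> k \<odot> u = \<mu> k" using v k by (simp add: \<mu>'_def)
      qed
    qed
    then show "\<exists>!u. u \<in> hom C M L \<and> (\<forall>k \<in> K. \<pi> k \<odot> u = \<mu> k)"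
      using ex1 by (metis (mono_tags, lifting))
  qed
  then show ?thesis unfolding solvable_def by blast
qed

section \<open>Particular limits as universal solutions\<close>

definition pair :: "'a \<Rightarrow> 'a \<Rightarrow> nat \<Rightarrow> 'a" where
  "pair x y k = (if k = 0 then x else y)"

lemma pair_simps [simp]: "pair x y 0 = x" "pair x y (Suc k) = y" "pair x y 1 = y"
  by (simp_all add: pair_def)

text \<open>Universal properties are stated for one or two test arrows, systems for families indexed by the
  unknowns; quantifying over the former or over the latter amounts to the same.\<close>

lemma all_pair: "(\<forall>x y. P x y) \<longleftrightarrow> (\<forall>\<mu> :: nat \<Rightarrow> 'a. P (\<mu> 0) (\<mu> 1))"
proof safe
  fix x y
  assume "\<forall>\<mu> :: nat \<Rightarrow> 'a. P (\<mu> 0) (\<mu> 1)"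
  then have "P (pair x y 0) (pair x y 1)" by blast
  then show "P x y" by simp
qed blast

lemma all_single: "(\<forall>x. P x) \<longleftrightarrow> (\<forall>\<mu> :: nat \<Rightarrow> 'a. P (\<mu> 0))"
proof safe
  fix x
  assume "\<forall>\<mu> :: nat \<Rightarrow> 'a. P (\<mu> 0)"
  from spec[OF this, of "\<lambda>_. x"] show "P x" .
qed blast

lemma pullback_iff:
  assumes f: "f \<in> hom C A Y" and g: "g \<in> hom C B Y" and p: "p \<in> hom C P A" and q: "q \<in> hom C P B"
  shows "pullback C p q f g \<longleftrightarrow> f \<odot>\<^bsub>C\<^esub> p = g \<odot>\<^bsub>C\<^esub> q \<and>
    (\<forall>T x y. x \<in> hom C T A \<and> y \<in> hom C T B \<and> f \<odot>\<^bsub>C\<^esub> x = g \<odot>\<^bsub>C\<^esub> y \<longrightarrow>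
      (\<exists>!u. u \<in> hom C T P \<and> p \<odot>\<^bsub>C\<^esub> u = x \<and> q \<odot>\<^bsub>C\<^esub> u = y))"
proof -
  have "f \<in> Ar C" "g \<in> Ar C" "p \<in> Ar C" "q \<in> Ar C" "Dom C f = A" "Dom C g = B" "Cod C f = Y"
    "Cod C g = Y" "Dom C p = P" "Dom C q = P" "Cod C p = A" "Cod C q = B"
    using assms by (simp_all add: hom_def)
  then show ?thesis unfolding pullback_def Ball_def by (simp only: simp_thms) blast
qed

lemma equalizer_iff:
  assumes f: "f \<in> hom C A B" and g: "g \<in> hom C A B" and e: "e \<in> hom C E A"
  shows "equalizer C e f g \<longleftrightarrow> f \<odot>\<^bsub>C\<^esub> e = g \<odot>\<^bsub>C\<^esub> e \<and>
    (\<forall>T h. h \<in> hom C T A \<and> f \<odot>\<^bsub>C\<^esub> h = g \<odot>\<^bsub>C\<^esub> h \<longrightarrow>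
      (\<exists>!u. u \<in> hom C T E \<and> e \<odot>\<^bsub>C\<^esub> u = h))"
proof -
  have "f \<in> Ar C" "e \<in> Ar C" "Dom C f = A" "Cod C f = B" "Dom C e = E" "Cod C e = A"
    using assms by (simp_all add: hom_def)
  moreover have "h \<in> hom C T A \<longleftrightarrow> h \<in> Ar C \<and> Dom C h = T \<and> Cod C h = A" for h T
    by (simp add: hom_def)
  ultimately show ?thesis using g unfolding equalizer_def Ball_def by (simp only: simp_thms) blast
qed

lemma coequalizer_iff:
  assumes f: "f \<in> hom C A B" and g: "g \<in> hom C A B" and q: "q \<in> hom C B Q"
  shows "coequalizer C q f g \<longleftrightarrow> q \<odot>\<^bsub>C\<^esub> f = q \<odot>\<^bsub>C\<^esub> g \<and>
    (\<forall>T h. h \<in> hom C B T \<and> h \<odot>\<^bsub>C\<^esub> f = h \<odot>\<^bsub>C\<^esub> g \<longrightarrow>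
      (\<exists>!u. u \<in> hom C Q T \<and> u \<odot>\<^bsub>C\<^esub> q = h))"
  using equalizer_iff[of f "opp C" B A g q Q] assms by (simp add: coequalizer_opp)

lemma pullbackD:
  assumes "pullback C p q f g"
  shows "f \<in> hom C (Cod C p) (Cod C f)" "g \<in> hom C (Cod C q) (Cod C f)"
    "p \<in> hom C (Dom C p) (Cod C p)" "q \<in> hom C (Dom C p) (Cod C q)" "f \<odot>\<^bsub>C\<^esub> p = g \<odot>\<^bsub>C\<^esub> q"
  using assms unfolding pullback_def hom_def by simp_all

lemma pullback_factor:
  assumes "pullback C p q f g" "f \<in> hom C A Y" "g \<in> hom C B Y" "p \<in> hom C P A" "q \<in> hom C P B"
    and "x \<in> hom C T A" "y \<in> hom C T B" "f \<odot>\<^bsub>C\<^esub> x = g \<odot>\<^bsub>C\<^esub> y"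
  obtains u where "u \<in> hom C T P" "p \<odot>\<^bsub>C\<^esub> u = x" "q \<odot>\<^bsub>C\<^esub> u = y"
  using assms(1,6-) that unfolding pullback_iff[OF assms(2-5)] by metis

lemma equalizerD:
  assumes "equalizer C e f g"
  shows "f \<in> hom C (Cod C e) (Cod C f)" "g \<in> hom C (Cod C e) (Cod C f)"
    "e \<in> hom C (Dom C e) (Cod C e)"
  using assms unfolding equalizer_def hom_def by simp_all

lemma coequalizerD:
  assumes "coequalizer C q f g"
  shows "f \<in> hom C (Dom C f) (Dom C q)" "g \<in> hom C (Dom C f) (Dom C q)"
    "q \<in> hom C (Dom C q) (Cod C q)"
  using assms unfolding coequalizer_def hom_def by simp_all

lemma coproduct_iff_universal:
  "coproduct C K X S \<iota> \<longleftrightarrow> universal_solution (opp C) K X {} S \<iota>"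
  unfolding coproduct_def universal_solution_def solution_def by simp

context category
begin

lemma eq_system_pullback:
  assumes "f \<in> hom C A Y" "g \<in> hom C B Y"
  shows "eq_system C {0, 1} (pair A B) {(0, f, 1, g)}"
  using assms hom_Ob unfolding eq_system_def by auto

lemma pullback_iff_universal:
  assumes f: "f \<in> hom C A Y" and g: "g \<in> hom C B Y" and p: "p \<in> hom C P A" and q: "q \<in> hom C P B"
  shows "pullback C p q f g \<longleftrightarrow>
    universal_solution C {0, 1} (pair A B) {(0, f, 1, g)} P (pair p q)"
proof -
  have sol: "solution C {0, 1} (pair A B) {(0, f, 1, g)} M \<mu> \<longleftrightarrow>
      \<mu> 0 \<in> hom C M A \<and> \<mu> 1 \<in> hom C M B \<and> f \<odot> \<mu> 0 = g \<odot> \<mu> 1" for M \<mu>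
    unfolding solution_def using hom_Ob by auto
  have "(\<forall>T x y. x \<in> hom C T A \<and> y \<in> hom C T B \<and> f \<odot> x = g \<odot> y \<longrightarrow>
        (\<exists>!u. u \<in> hom C T P \<and> p \<odot> u = x \<and> q \<odot> u = y)) \<longleftrightarrow>
      (\<forall>T \<mu>. \<mu> 0 \<in> hom C T A \<and> \<mu> (1 :: nat) \<in> hom C T B \<and> f \<odot> \<mu> 0 = g \<odot> \<mu> 1 \<longrightarrow>
        (\<exists>!u. u \<in> hom C T P \<and> p \<odot> u = \<mu> 0 \<and> q \<odot> u = \<mu> 1))"
    by (intro iff_allI all_pair)
  then have "pullback C p q f g \<longleftrightarrow> f \<odot> p = g \<odot> q \<and>
      (\<forall>T \<mu>. \<mu> 0 \<in> hom C T A \<and> \<mu> (1 :: nat) \<in> hom C T B \<and> f \<odot> \<mu> 0 = g \<odot> \<mu> 1 \<longrightarrow>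
        (\<exists>!u. u \<in> hom C T P \<and> p \<odot> u = \<mu> 0 \<and> q \<odot> u = \<mu> 1))"
    unfolding pullback_iff[OF assms] by (rule arg_cong)
  also have "\<dots> \<longleftrightarrow> universal_solution C {0, 1} (pair A B) {(0, f, 1, g)} P (pair p q)"
    unfolding universal_solution_def sol using p q by simp
  finally show ?thesis .
qed

lemma pullback_exists_iff:
  assumes f: "f \<in> hom C A Y" and g: "g \<in> hom C B Y"
  shows "(\<exists>p q. pullback C p q f g) \<longleftrightarrow> solvable C {0, 1} (pair A B) {(0, f, 1, g)}"
proof
  assume "\<exists>p q. pullback C p q f g"
  then obtain p q where pb: "pullback C p q f g" by blast
  have "p \<in> hom C (Dom C p) A" "q \<in> hom C (Dom C p) B"
    using pb homD[OF f] homD[OF g] unfolding pullback_def hom_def by simp_all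
  then show "solvable C {0, 1} (pair A B) {(0, f, 1, g)}"
    using pb pullback_iff_universal[OF f g] unfolding solvable_def by blast
next
  assume "solvable C {0, 1} (pair A B) {(0, f, 1, g)}"
  then obtain P \<pi> where U: "universal_solution C {0, 1} (pair A B) {(0, f, 1, g)} P \<pi>"
    unfolding solvable_def by blast
  have "\<pi> 0 \<in> hom C P A" "\<pi> 1 \<in> hom C P B"
    using universal_solutionD(2)[OF U, of 0] universal_solutionD(2)[OF U, of 1] by simp_all
  moreover have "universal_solution C {0, 1} (pair A B) {(0, f, 1, g)} P (pair (\<pi> 0) (\<pi> 1))"
    using U unfolding universal_solution_def solution_def by simp
  ultimately show "\<exists>p q. pullback C p q f g"
    using pullback_iff_universal[OF f g] by blast
qed

lemma pullback_exists:
  assumes "finitely_complete C" "f \<in> hom C A Y" "g \<in> hom C B Y"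
  shows "\<exists>p q. pullback C p q f g"
  unfolding pullback_exists_iff[OF assms(2,3)]
  by (rule finite_systems_solvable[OF assms(1) _ _ eq_system_pullback[OF assms(2,3)]]) simp_all

lemma eq_system_equalizer:
  assumes "f \<in> hom C A B" "g \<in> hom C A B"
  shows "eq_system C {0 :: nat} (\<lambda>_. A) {(0, f, 0, g)}"
  using assms hom_Ob unfolding eq_system_def by auto

lemma equalizer_iff_universal:
  assumes f: "f \<in> hom C A B" and g: "g \<in> hom C A B" and e: "e \<in> hom C E A"
  shows "equalizer C e f g \<longleftrightarrow> universal_solution C {0 :: nat} (\<lambda>_. A) {(0, f, 0, g)} E (\<lambda>_. e)"
proof -
  have sol: "solution C {0 :: nat} (\<lambda>_. A) {(0, f, 0, g)} M \<mu> \<longleftrightarrow>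
      \<mu> 0 \<in> hom C M A \<and> f \<odot> \<mu> 0 = g \<odot> \<mu> 0" for M \<mu>
    unfolding solution_def using hom_Ob by auto
  have "(\<forall>T h. h \<in> hom C T A \<and> f \<odot> h = g \<odot> h \<longrightarrow> (\<exists>!u. u \<in> hom C T E \<and> e \<odot> u = h)) \<longleftrightarrow>
      (\<forall>T \<mu>. \<mu> (0 :: nat) \<in> hom C T A \<and> f \<odot> \<mu> 0 = g \<odot> \<mu> 0 \<longrightarrow>
        (\<exists>!u. u \<in> hom C T E \<and> e \<odot> u = \<mu> 0))"
    by (intro iff_allI all_single)
  then have "equalizer C e f g \<longleftrightarrow> f \<odot> e = g \<odot> e \<and>
      (\<forall>T \<mu>. \<mu> (0 :: nat) \<in> hom C T A \<and> f \<odot> \<mu> 0 = g \<odot> \<mu> 0 \<longrightarrow>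
        (\<exists>!u. u \<in> hom C T E \<and> e \<odot> u = \<mu> 0))"
    unfolding equalizer_iff[OF assms] by (rule arg_cong)
  also have "\<dots> \<longleftrightarrow> universal_solution C {0 :: nat} (\<lambda>_. A) {(0, f, 0, g)} E (\<lambda>_. e)"
    unfolding universal_solution_def sol using e by simp
  finally show ?thesis .
qed

lemma equalizer_exists_iff:
  assumes f: "f \<in> hom C A B" and g: "g \<in> hom C A B"
  shows "(\<exists>e. equalizer C e f g) \<longleftrightarrow> solvable C {0 :: nat} (\<lambda>_. A) {(0, f, 0, g)}"
proof
  assume "\<exists>e. equalizer C e f g"
  then obtain e where eq: "equalizer C e f g" by blast
  have "e \<in> hom C (Dom C e) A" using equalizerD[OF eq] homD[OF f] by (simp add: hom_def)
  then show "solvable C {0 :: nat} (\<lambda>_. A) {(0, f, 0, g)}"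
    using eq equalizer_iff_universal[OF f g] unfolding solvable_def by blast
next
  assume "solvable C {0 :: nat} (\<lambda>_. A) {(0, f, 0, g)}"
  then obtain L \<pi> where U: "universal_solution C {0 :: nat} (\<lambda>_. A) {(0, f, 0, g)} L \<pi>"
    unfolding solvable_def by blast
  have "\<pi> 0 \<in> hom C L A" using universal_solutionD(2)[OF U, of 0] by simp
  moreover have "universal_solution C {0 :: nat} (\<lambda>_. A) {(0, f, 0, g)} L (\<lambda>_. \<pi> 0)"
    using U unfolding universal_solution_def solution_def by simp
  ultimately show "\<exists>e. equalizer C e f g" using equalizer_iff_universal[OF f g] by blast
qed

lemma equalizer_exists:
  assumes "finitely_complete C" "f \<in> hom C A B" "g \<in> hom C A B"
  shows "\<exists>e. equalizer C e f g"
  unfolding equalizer_exists_iff[OF assms(2,3)]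
  by (rule finite_systems_solvable[OF assms(1) _ _ eq_system_equalizer[OF assms(2,3)]]) simp_all

lemma terminal_iff_universal:
  "terminal_object C z \<longleftrightarrow> universal_solution C ({} :: nat set) X {} z \<pi>"
  unfolding terminal_object_def universal_solution_def solution_def by auto

lemma eq_system_jointly_monic:
  assumes "d \<in> hom C R X" "e \<in> hom C R X"
  shows "eq_system C {0, 1 :: nat} (\<lambda>_. R) {(0, d, 1, d), (0, e, 1, e)}"
  using assms hom_Ob unfolding eq_system_def by auto

text \<open>Joint monicity becomes a limit condition: the pairs of arrows identified by both \<open>d\<close> and \<open>e\<close>
  are represented by \<open>R\<close> itself, embedded diagonally.\<close>

lemma jointly_monic_iff_universal:
  assumes d: "d \<in> hom C R X" and e: "e \<in> hom C R X"
  shows "jointly_monic C d e \<longleftrightarrow> universal_solution C {0, 1 :: nat} (\<lambda>_. R)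
    {(0, d, 1, d), (0, e, 1, e)} R (\<lambda>_. Ide C R)"
proof -
  have sol: "solution C {0, 1 :: nat} (\<lambda>_. R) {(0, d, 1, d), (0, e, 1, e)} M \<mu> \<longleftrightarrow>
      \<mu> 0 \<in> hom C M R \<and> \<mu> 1 \<in> hom C M R \<and> d \<odot> \<mu> 0 = d \<odot> \<mu> 1 \<and> e \<odot> \<mu> 0 = e \<odot> \<mu> 1" for M \<mu>
    unfolding solution_def using hom_Ob by auto
  have R: "Ide C R \<in> hom C R R" using ide_in_hom hom_Ob d by blast
  have factor: "(\<exists>!u. u \<in> hom C M R \<and> (\<forall>k \<in> {0, 1 :: nat}. Ide C R \<odot> u = \<mu> k)) \<longleftrightarrow> \<mu> 0 = \<mu> 1"
    if \<mu>: "\<mu> 0 \<in> hom C M R" for M \<mu>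
  proof -
    have "u \<in> hom C M R \<and> (\<forall>k \<in> {0, 1 :: nat}. Ide C R \<odot> u = \<mu> k) \<longleftrightarrow> u = \<mu> 0 \<and> \<mu> 0 = \<mu> 1" for u
      using comp_ide_left[of u M R] \<mu> by auto
    then show ?thesis unfolding Ex1_def by auto
  qed
  have "universal_solution C {0, 1 :: nat} (\<lambda>_. R)
      {(0, d, 1, d), (0, e, 1, e)} R (\<lambda>_. Ide C R) \<longleftrightarrow>
    (\<forall>M \<mu>. \<mu> (0 :: nat) \<in> hom C M R \<and> \<mu> 1 \<in> hom C M R \<and>
       d \<odot> \<mu> 0 = d \<odot> \<mu> 1 \<and> e \<odot> \<mu> 0 = e \<odot> \<mu> 1 \<longrightarrow> \<mu> 0 = \<mu> 1)"
    unfolding universal_solution_def sol using R factor by (simp cong: imp_cong conj_cong)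
  also have "\<dots> \<longleftrightarrow> (\<forall>M x y. x \<in> hom C M R \<and> y \<in> hom C M R \<and>
       d \<odot> x = d \<odot> y \<and> e \<odot> x = e \<odot> y \<longrightarrow> x = y)"
    by (intro iff_allI all_pair[symmetric])
  also have "\<dots> \<longleftrightarrow> jointly_monic C d e"
    unfolding jointly_monic_def using homD[OF d] by auto
  finally show ?thesis by blast
qed

section \<open>Kernel pairs and coequalizers\<close>

text \<open>The pair of which \<open>q\<close> is the coequalizer factors through the kernel pair of \<open>q\<close>.\<close>

lemma coequalizer_of_kernel_pair:
  assumes q: "coequalizer C q f g" and kp: "kernel_pair C p1 p2 q"
  shows "coequalizer C q p1 p2"
proof -
  have pb: "pullback C p1 p2 q q" using kp unfolding kernel_pair_def .
  note fg = coequalizerD[OF q]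
  have P: "p1 \<in> hom C (Dom C p1) (Dom C q)" "p2 \<in> hom C (Dom C p1) (Dom C q)"
    using pb unfolding pullback_def hom_def by simp_all
  have q': "q \<odot> f = q \<odot> g" "\<And>T h. h \<in> hom C (Dom C q) T \<Longrightarrow> h \<odot> f = h \<odot> g \<Longrightarrow>
      (\<exists>!u. u \<in> hom C (Cod C q) T \<and> u \<odot> q = h)"
    using q unfolding coequalizer_iff[OF fg] by blast+
  obtain u where u: "u \<in> hom C (Dom C f) (Dom C p1)" "p1 \<odot> u = f" "p2 \<odot> u = g"
    using pullback_factor[OF pb fg(3,3) P fg(1,2) q'(1)] by blast
  have "h \<odot> f = h \<odot> g" if h: "h \<in> hom C (Dom C q) T" "h \<odot> p1 = h \<odot> p2" for h T
    using comp_assoc[OF u(1) P(1) h(1)] comp_assoc[OF u(1) P(2) h(1)] u(2,3) h(2) by simp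
  then show ?thesis
    unfolding coequalizer_iff[OF P fg(3)] using q'(2) pullbackD(5)[OF pb] by blast
qed

text \<open>If \<open>(d, e)\<close> is the kernel pair of \<open>f\<close>, then \<open>f\<close> factors through the coequalizer \<open>c\<close>, so arrows
  identified by \<open>c\<close> are identified by \<open>f\<close>.\<close>

lemma kernel_pair_of_coequalizer:
  assumes kp: "kernel_pair C d e f" and c: "coequalizer C c d e"
  shows "kernel_pair C d e c"
proof -
  have pb: "pullback C d e f f" using kp unfolding kernel_pair_def .
  note f = pullbackD(1)[OF pb]
  have R: "d \<in> hom C (Dom C d) (Cod C d)" "e \<in> hom C (Dom C d) (Cod C d)"
    and c_hom: "c \<in> hom C (Cod C d) (Cod C c)"
    using c unfolding coequalizer_def hom_def by simp_all
  note c' = c[unfolded coequalizer_iff[OF R c_hom]]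
  have univ: "\<exists>!u. u \<in> hom C T (Dom C d) \<and> d \<odot> u = x \<and> e \<odot> u = y"
    if "x \<in> hom C T (Cod C d)" "y \<in> hom C T (Cod C d)" "f \<odot> x = f \<odot> y" for T x y
    using pb that unfolding pullback_iff[OF f f R] by blast
  obtain v where v: "v \<in> hom C (Cod C c) (Cod C f)" "v \<odot> c = f"
    using c' f pullbackD(5)[OF pb] by blast
  have "f \<odot> x = f \<odot> y"
    if xy: "x \<in> hom C T (Cod C d)" "y \<in> hom C T (Cod C d)" "c \<odot> x = c \<odot> y" for T x y
    using comp_assoc[OF xy(1) c_hom v(1)] comp_assoc[OF xy(2) c_hom v(1)] xy(3) v(2) by simp
  then show ?thesis
    unfolding kernel_pair_def pullback_iff[OF c_hom c_hom R] using univ c' by blast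
qed

end

section \<open>Limits and colimits of functors are pointwise\<close>

context functor_category
begin

lemma evaluate_pair: "(\<lambda>k. obj (pair A B k) a) = pair (obj A a) (obj B a)"
  "(\<lambda>k. cmp (pair p q k) a) = pair (cmp p a) (cmp q a)"
  by (auto simp: pair_def fun_eq_iff)

theorem finitely_complete:
  assumes fc: "finitely_complete C"
  shows "finitely_complete D"
  unfolding finitely_complete_def
proof (intro allI impI)
  fix J :: "(nat, nat) cat" and F
  assume "finite_cat J \<and> is_functor J D F"
  then have J: "category J" "finite (Ob J)" "finite (Ar J)" and F: "is_functor J D F"
    by (auto simp: finite_cat_def)
  note E = D.eq_system_cone_equations[OF J(1) F]
  have fin: "finite (cone_equations J D F)" using J by (simp add: cone_equations_def)
  have "solvable D (Ob J) (FOb F) (cone_equations J D F)"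
    using solvable_if_pointwise[OF E]
      C.finite_systems_solvable[OF fc J(2) finite_eval_at[OF fin] eq_system_eval[OF E]] by blast
  then show "\<exists>L \<pi>. limit_cone J D F L \<pi>"
    unfolding solvable_def D.limit_cone_iff_universal[OF J(1) F] .
qed

lemma eq_system_pullback_eval:
  assumes f: "f \<in> hom D A Y" and g: "g \<in> hom D B Y"
    and pw: "\<And>a. a \<in> Ob I \<Longrightarrow> \<exists>p q. pullback C p q (cmp f a) (cmp g a)" and a: "a \<in> Ob I"
  shows "solvable C {0, 1} (\<lambda>k. obj (pair A B k) a) (eval_at a {(0, f, 1, g)})"
  using pw[OF a] C.pullback_exists_iff[OF cmp_hom[OF f a] cmp_hom[OF g a]]
  by (simp add: evaluate_pair)

lemma pullback_exists_pointwise: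
  assumes f: "f \<in> hom D A Y" and g: "g \<in> hom D B Y"
    and pw: "\<And>a. a \<in> Ob I \<Longrightarrow> \<exists>p q. pullback C p q (cmp f a) (cmp g a)"
  shows "\<exists>p q. pullback D p q f g"
  unfolding D.pullback_exists_iff[OF f g]
  by (rule solvable_if_pointwise[OF D.eq_system_pullback[OF f g]])
    (rule eq_system_pullback_eval[OF assms])

lemma pullback_iff_pointwise:
  assumes f: "f \<in> hom D A Y" and g: "g \<in> hom D B Y" and p: "p \<in> hom D P A" and q: "q \<in> hom D P B"
    and pw: "\<And>a. a \<in> Ob I \<Longrightarrow> \<exists>p q. pullback C p q (cmp f a) (cmp g a)"
  shows "pullback D p q f g \<longleftrightarrow> (\<forall>a \<in> Ob I. pullback C (cmp p a) (cmp q a) (cmp f a) (cmp g a))"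
proof -
  have P: "P \<in> Ob D" using D.hom_Ob p by blast
  have "k \<in> {0, 1} \<Longrightarrow> pair p q k \<in> hom D P (pair A B k)" for k using p q by auto
  then have "pullback D p q f g \<longleftrightarrow> (\<forall>a \<in> Ob I. universal_solution C {0, 1}
      (pair (obj A a) (obj B a)) {(0, cmp f a, 1, cmp g a)} (obj P a) (pair (cmp p a) (cmp q a)))"
    unfolding D.pullback_iff_universal[OF f g p q]
    using universal_iff_pointwise[OF D.eq_system_pullback[OF f g]
        eq_system_pullback_eval[OF f g pw] P, of "pair p q"] by (simp add: evaluate_pair)
  then show ?thesis
    using C.pullback_iff_universal[OF cmp_hom[OF f] cmp_hom[OF g] cmp_hom[OF p] cmp_hom[OF q]]
    by simp
qed

lemma kernel_pair_pointwise:
  assumes fc: "finitely_complete C" and f: "f \<in> hom D A B" and p: "p \<in> hom D P A" and q: "q \<in> hom D P A"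
  shows "kernel_pair D p q f \<longleftrightarrow> (\<forall>a \<in> Ob I. kernel_pair C (cmp p a) (cmp q a) (cmp f a))"
  unfolding kernel_pair_def
  by (rule pullback_iff_pointwise[OF f f p q]) (use C.pullback_exists[OF fc] cmp_hom[OF f] in blast)

lemma equalizer_exists_pointwise:
  assumes f: "f \<in> hom D A B" and g: "g \<in> hom D A B"
    and pw: "\<And>a. a \<in> Ob I \<Longrightarrow> \<exists>e. equalizer C e (cmp f a) (cmp g a)"
  shows "\<exists>e. equalizer D e f g"
  unfolding D.equalizer_exists_iff[OF f g]
proof (rule solvable_if_pointwise[OF D.eq_system_equalizer[OF f g]])
  fix a assume a: "a \<in> Ob I"
  show "solvable C {0 :: nat} (\<lambda>k. obj A a) (eval_at a {(0, f, 0, g)})"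
    using pw[OF a] C.equalizer_exists_iff[OF cmp_hom[OF f a] cmp_hom[OF g a]] by simp
qed

lemma equalizer_iff_pointwise:
  assumes f: "f \<in> hom D A B" and g: "g \<in> hom D A B" and e: "e \<in> hom D E A"
    and pw: "\<And>a. a \<in> Ob I \<Longrightarrow> \<exists>e. equalizer C e (cmp f a) (cmp g a)"
  shows "equalizer D e f g \<longleftrightarrow> (\<forall>a \<in> Ob I. equalizer C (cmp e a) (cmp f a) (cmp g a))"
proof -
  have "solvable C {0 :: nat} (\<lambda>k. obj A a) (eval_at a {(0, f, 0, g)})" if a: "a \<in> Ob I" for a
    using pw[OF a] C.equalizer_exists_iff[OF cmp_hom[OF f a] cmp_hom[OF g a]] by simp
  then have "equalizer D e f g \<longleftrightarrow> (\<forall>a \<in> Ob I. universal_solution C {0 :: nat}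
      (\<lambda>_. obj A a) {(0, cmp f a, 0, cmp g a)} (obj E a) (\<lambda>_. cmp e a))"
    unfolding D.equalizer_iff_universal[OF f g e]
    using universal_iff_pointwise[OF D.eq_system_equalizer[OF f g], of E "\<lambda>_. e"] e D.hom_Ob
    by simp
  then show ?thesis
    using C.equalizer_iff_universal[OF cmp_hom[OF f] cmp_hom[OF g] cmp_hom[OF e]] by simp
qed

lemma coequalizer_exists_pointwise:
  assumes "f \<in> hom D A B" "g \<in> hom D A B"
    and "\<And>a. a \<in> Ob I \<Longrightarrow> \<exists>q. coequalizer C q (cmp f a) (cmp g a)"
  shows "\<exists>q. coequalizer D q f g"
  using functor_category.equalizer_exists_pointwise[OF functor_category_opp, of f B A g] assms
  by (simp add: coequalizer_opp)

lemma coequalizer_iff_pointwise: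
  assumes "f \<in> hom D A B" "g \<in> hom D A B" "q \<in> hom D B Q"
    and "\<And>a. a \<in> Ob I \<Longrightarrow> \<exists>q. coequalizer C q (cmp f a) (cmp g a)"
  shows "coequalizer D q f g \<longleftrightarrow> (\<forall>a \<in> Ob I. coequalizer C (cmp q a) (cmp f a) (cmp g a))"
  using functor_category.equalizer_iff_pointwise[OF functor_category_opp, of f B A g q Q] assms
  by (simp add: coequalizer_opp)

lemma has_finite_coproducts:
  assumes C: "has_finite_coproducts C"
  shows "has_finite_coproducts D"
  unfolding has_finite_coproducts_def
proof (intro allI impI)
  fix n :: nat and X assume X: "\<forall>k<n. X k \<in> Ob D"
  interpret opp: functor_category "opp I" "opp C" "opp D" obj act cmp
    by (rule functor_category_opp)
  have "solvable (opp D) {..<n} X {}"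
  proof (rule opp.solvable_if_pointwise)
    show "eq_system (opp D) {..<n} X {}" using X by (simp add: eq_system_def)
    fix a assume "a \<in> Ob (opp I)"
    then have "\<forall>k<n. obj (X k) a \<in> Ob C" using X obj_Ob by simp
    then have "\<exists>S \<iota>. coproduct C {..<n} (\<lambda>k. obj (X k) a) S \<iota>"
      using C[unfolded has_finite_coproducts_def, rule_format, of n "\<lambda>k. obj (X k) a"] by simp
    then show "solvable (opp C) {..<n} (\<lambda>k. obj (X k) a) (opp.eval_at a {})"
      unfolding coproduct_iff_universal solvable_def opp.eval_at_simps .
  qed
  then show "\<exists>S \<iota>. coproduct D {..<n} X S \<iota>"
    unfolding coproduct_iff_universal solvable_def .
qed

lemma jointly_monic_iff_pointwise:
  assumes fc: "finitely_complete C" and d: "d \<in> hom D R X" and e: "e \<in> hom D R X"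
  shows "jointly_monic D d e \<longleftrightarrow> (\<forall>a \<in> Ob I. jointly_monic C (cmp d a) (cmp e a))"
proof -
  let ?E = "{(0, d, 1, d), (0, e, 1, e)} :: (nat \<times> _ \<times> nat \<times> _) set"
  have R: "R \<in> Ob D" using D.hom_Ob d by blast
  note E = D.eq_system_jointly_monic[OF d e]
  have "jointly_monic D d e \<longleftrightarrow> (\<forall>a \<in> Ob I. universal_solution C {0, 1 :: nat}
      (\<lambda>_. obj R a) (eval_at a ?E) (obj R a) (\<lambda>_. cmp (Ide D R) a))"
    unfolding D.jointly_monic_iff_universal[OF d e]
    by (rule universal_iff_pointwise[OF E _ R])
      (use C.finite_systems_solvable[OF fc _ _ eq_system_eval[OF E]] D.ide_in_hom[OF R] in simp_all)
  then show ?thesis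
    using C.jointly_monic_iff_universal[OF cmp_hom[OF d] cmp_hom[OF e]] cmp_ide[OF R] by simp
qed

lemma terminal_if_pointwise:
  assumes "z \<in> Ob D" "\<And>a. a \<in> Ob I \<Longrightarrow> terminal_object C (obj z a)"
  shows "terminal_object D z"
  \<comment> \<open>There are no unknowns, so their codomains and the projections are arbitrary.\<close>
  unfolding D.terminal_iff_universal[of z undefined undefined]
  by (rule universal_if_pointwise) (use assms C.terminal_iff_universal in \<open>auto simp: eq_system_def\<close>)

lemma terminal_pointwise:
  assumes "terminal_object C c" "terminal_object D z" "a \<in> Ob I"
  shows "terminal_object C (obj z a)"
proof -
  have "eq_system D ({} :: nat set) undefined {}" by (simp add: eq_system_def)
  from universal_pointwise[OF this, of z undefined a] show ?thesis
    using assms C.terminal_iff_universal D.terminal_iff_universal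
    unfolding solvable_def by (metis eval_at_simps(1))
qed

lemma zero_if_pointwise:
  assumes "z \<in> Ob D" "\<And>a. a \<in> Ob I \<Longrightarrow> zero_object C (obj z a)"
  shows "zero_object D z"
  using assms terminal_if_pointwise[of z]
    functor_category.terminal_if_pointwise[OF functor_category_opp, of z]
  by (simp add: zero_object_def initial_opp)

text \<open>Any zero object of the functor category evaluates to zero objects, not only the constant functor;
  zero arrows may factor through any of them.\<close>

lemma zero_pointwise:
  assumes "zero_object C c" "zero_object D z" "a \<in> Ob I"
  shows "zero_object C (obj z a)"
  using assms terminal_pointwise[of c z a]
    functor_category.terminal_pointwise[OF functor_category_opp, of c z a]
  by (simp add: zero_object_def initial_opp)

lemma pointed:
  assumes "pointed C"
  shows "pointed D"
proof -
  obtain c where c: "zero_object C c" using assms unfolding pointed_def by blast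
  then have cO: "c \<in> Ob C" by (simp add: zero_object_def terminal_object_def)
  note i = C.ide_in_hom[OF cO]
  have "\<exists>F\<in>Ob D. (\<forall>a\<in>Ob I. obj F a = c) \<and> (\<forall>f\<in>Ar I. act F f = Ide C c)"
    by (rule functor_exists) (use cO i C.comp_ide_left[OF i] in simp_all)
  then obtain z where "z \<in> Ob D" "\<forall>a\<in>Ob I. obj z a = c" by blast
  then have "zero_object D z" using zero_if_pointwise c by simp
  then show ?thesis unfolding pointed_def using D.category_axioms by blast
qed

lemma zero_arrow_pointwise:
  assumes C: "pointed C" and t: "zero_arrow D t" and a: "a \<in> Ob I"
  shows "zero_arrow C (cmp t a)"
proof -
  obtain c where c: "zero_object C c" using C unfolding pointed_def by blast
  obtain z u v where z: "zero_object D z" and u: "u \<in> hom D (Dom D t) z" and v: "v \<in> hom D z (Cod D t)"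
    and t': "t \<in> Ar D" "t = v \<odot>\<^bsub>D\<^esub> u"
    using t unfolding zero_arrow_def by blast
  have h: "cmp t a \<in> hom C (obj (Dom D t) a) (obj (Cod D t) a)"
    using cmp_hom[OF hom_self[OF t'(1)] a] .
  have "cmp t a = cmp v a \<odot>\<^bsub>C\<^esub> cmp u a" using cmp_comp[OF u v a] t'(2) by simp
  then show ?thesis
    unfolding zero_arrow_def
    using homD[OF h] zero_pointwise[OF c z a] cmp_hom[OF u a] cmp_hom[OF v a] by auto
qed

lemma kernel_pointwise:
  assumes fc: "finitely_complete C" and C: "pointed C" and k: "kernel D k f" and a: "a \<in> Ob I"
  shows "kernel C (cmp k a) (cmp f a)"
proof -
  obtain z where z: "zero_arrow D z" and eq: "equalizer D k f z"
    using k unfolding kernel_def by blast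
  note h = equalizerD[OF eq]
  have "equalizer C (cmp k a) (cmp f a) (cmp z a)"
    using equalizer_iff_pointwise[OF h] eq a C.equalizer_exists[OF fc cmp_hom[OF h(1)] cmp_hom[OF h(2)]]
    by blast
  then show ?thesis unfolding kernel_def using zero_arrow_pointwise[OF C z a] by blast
qed

text \<open>Inverses of the components of a natural transformation are natural: the naturality square of \<open>t\<close>
  is composed with the inverse on either side.\<close>

lemma iso_if_pointwise:
  assumes t: "t \<in> hom D F G" and pw: "\<And>a. a \<in> Ob I \<Longrightarrow> iso C (cmp t a)"
  shows "iso D t"
proof -
  have FG: "F \<in> Ob D" "G \<in> Ob D" using t D.hom_Ob by blast+
  have "\<exists>v. v \<in> hom C (obj G a) (obj F a) \<and> v \<odot>\<^bsub>C\<^esub> cmp t a = Ide C (obj F a) \<and>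
      cmp t a \<odot>\<^bsub>C\<^esub> v = Ide C (obj G a)" if "a \<in> Ob I" for a
    using C.isoE[OF pw[OF that] cmp_hom[OF t that]] by metis
  then obtain \<tau> where \<tau>: "\<And>a. a \<in> Ob I \<Longrightarrow> \<tau> a \<in> hom C (obj G a) (obj F a)"
    and inv: "\<And>a. a \<in> Ob I \<Longrightarrow> \<tau> a \<odot>\<^bsub>C\<^esub> cmp t a = Ide C (obj F a)"
      "\<And>a. a \<in> Ob I \<Longrightarrow> cmp t a \<odot>\<^bsub>C\<^esub> \<tau> a = Ide C (obj G a)"
    by metis
  have nat: "\<tau> b \<odot>\<^bsub>C\<^esub> act G f = act F f \<odot>\<^bsub>C\<^esub> \<tau> a" if f: "f \<in> hom I a b" for f a b
  proof -
    have a: "a \<in> Ob I" and b: "b \<in> Ob I" using I.hom_Ob f by blast+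
    note h = act_hom[OF FG(1) f] act_hom[OF FG(2) f] \<tau>[OF a] \<tau>[OF b] cmp_hom[OF t a] cmp_hom[OF t b]
    have "\<tau> b \<odot>\<^bsub>C\<^esub> act G f = \<tau> b \<odot>\<^bsub>C\<^esub> (act G f \<odot>\<^bsub>C\<^esub> (cmp t a \<odot>\<^bsub>C\<^esub> \<tau> a))"
      using inv(2)[OF a] C.comp_ide_right[OF h(2)] by simp
    also have "\<dots> = \<tau> b \<odot>\<^bsub>C\<^esub> ((cmp t b \<odot>\<^bsub>C\<^esub> act F f) \<odot>\<^bsub>C\<^esub> \<tau> a)"
      using C.comp_assoc[OF h(3,5,2)] cmp_natural[OF t f] by simp
    also have "\<dots> = (\<tau> b \<odot>\<^bsub>C\<^esub> cmp t b) \<odot>\<^bsub>C\<^esub> (act F f \<odot>\<^bsub>C\<^esub> \<tau> a)"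
      using C.comp_assoc[OF h(3,1,6)] C.comp_assoc[OF C.comp_in_hom[OF h(3,1)] h(6,4)] by simp
    also have "\<dots> = act F f \<odot>\<^bsub>C\<^esub> \<tau> a"
      using inv(1)[OF b] C.comp_ide_left[OF C.comp_in_hom[OF h(3,1)]] by simp
    finally show ?thesis .
  qed
  obtain s where s: "s \<in> hom D G F" "\<And>a. a \<in> Ob I \<Longrightarrow> cmp s a = \<tau> a"
    using transformation_exists[OF FG(2,1) \<tau> nat] by blast
  have "s \<odot>\<^bsub>D\<^esub> t = Ide D F"
    by (rule transformation_eqI[OF D.comp_in_hom[OF t s(1)] D.ide_in_hom[OF FG(1)]])
      (simp add: cmp_comp[OF t s(1)] cmp_ide[OF FG(1)] s(2) inv)
  moreover have "t \<odot>\<^bsub>D\<^esub> s = Ide D G"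
    by (rule transformation_eqI[OF D.comp_in_hom[OF s(1) t] D.ide_in_hom[OF FG(2)]])
      (simp add: cmp_comp[OF s(1) t] cmp_ide[OF FG(2)] s(2) inv)
  ultimately show ?thesis using D.isoI[OF t s(1)] by blast
qed

section \<open>Protomodularity, regularity and exactness of categories of functors\<close>

lemma split_epi_pointwise:
  assumes "split_epi D q r" "a \<in> Ob I"
  shows "split_epi C (cmp q a) (cmp r a)"
proof -
  have q: "q \<in> hom D (Dom D q) (Cod D q)" and r: "r \<in> hom D (Cod D q) (Dom D q)"
    and qr: "q \<odot>\<^bsub>D\<^esub> r = Ide D (Cod D q)"
    using assms(1) unfolding split_epi_def hom_def by simp_all
  have "Cod D q \<in> Ob D" using q D.hom_Ob by blast
  then have "cmp q a \<odot>\<^bsub>C\<^esub> cmp r a = Ide C (obj (Cod D q) a)"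
    using cmp_comp[OF r q assms(2)] qr cmp_ide assms(2) by simp
  then show ?thesis
    using cmp_hom[OF q assms(2)] cmp_hom[OF r assms(2)] unfolding split_epi_def hom_def by simp
qed

text \<open>Splittings are preserved by evaluation, so exactly the pullbacks assumed to exist in \<open>C\<close> are
  needed.\<close>

lemma has_pullbacks_of_split_epis:
  assumes C: "has_pullbacks_of_split_epis C"
  shows "has_pullbacks_of_split_epis D"
  unfolding has_pullbacks_of_split_epis_def
proof (intro allI impI)
  fix f g r assume fg: "f \<in> Ar D \<and> split_epi D g r \<and> Cod D f = Cod D g"
  then have f: "f \<in> hom D (Dom D f) (Cod D f)" and g: "g \<in> hom D (Dom D g) (Cod D f)"
    unfolding split_epi_def hom_def by simp_all
  show "\<exists>p q. pullback D p q f g"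
  proof (rule pullback_exists_pointwise[OF f g])
    fix a assume a: "a \<in> Ob I"
    have "split_epi C (cmp g a) (cmp r a)" using split_epi_pointwise fg a by blast
    then show "\<exists>p q. pullback C p q (cmp f a) (cmp g a)"
      using C homD[OF cmp_hom[OF f a]] homD[OF cmp_hom[OF g a]]
      unfolding has_pullbacks_of_split_epis_def by metis
  qed
qed

text \<open>All data of the lemma, kernels included, evaluate to data of the same kind, and isomorphisms are
  detected pointwise. Preservation of kernels is where the equalizers of \<open>C\<close> enter.\<close>

lemma split_short_five_lemma:
  assumes fc: "finitely_complete C" and pt: "pointed C" and C: "split_short_five_lemma C"
  shows "split_short_five_lemma D"
  unfolding split_short_five_lemma_def
proof (intro allI impI, elim conjE)
  fix q r i p s k l m n
  assume qr: "split_epi D q r" and i: "kernel D i q" and ps: "split_epi D p s" and k: "kernel D k p"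
    and l: "l \<in> hom D (Dom D i) (Dom D k)" and m: "m \<in> hom D (Dom D q) (Dom D p)"
    and n: "n \<in> hom D (Cod D q) (Cod D p)"
    and mi: "m \<odot>\<^bsub>D\<^esub> i = k \<odot>\<^bsub>D\<^esub> l" and nq: "n \<odot>\<^bsub>D\<^esub> q = p \<odot>\<^bsub>D\<^esub> m" and mr: "m \<odot>\<^bsub>D\<^esub> r = s \<odot>\<^bsub>D\<^esub> n"
    and iso: "iso D l" "iso D n"
  have h: "q \<in> hom D (Dom D q) (Cod D q)" "r \<in> hom D (Cod D q) (Dom D q)"
    "p \<in> hom D (Dom D p) (Cod D p)" "s \<in> hom D (Cod D p) (Dom D p)"
    "i \<in> hom D (Dom D i) (Dom D q)" "k \<in> hom D (Dom D k) (Dom D p)"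
    using qr ps i k unfolding split_epi_def kernel_def equalizer_def hom_def by auto
  show "iso D m"
  proof (rule iso_if_pointwise[OF m])
    fix a assume a: "a \<in> Ob I"
    note h' = h[THEN cmp_hom, OF a] and lmn = l[THEN cmp_hom, OF a] m[THEN cmp_hom, OF a] n[THEN cmp_hom, OF a]
    have "cmp m a \<odot>\<^bsub>C\<^esub> cmp i a = cmp k a \<odot>\<^bsub>C\<^esub> cmp l a"
      "cmp n a \<odot>\<^bsub>C\<^esub> cmp q a = cmp p a \<odot>\<^bsub>C\<^esub> cmp m a"
      "cmp m a \<odot>\<^bsub>C\<^esub> cmp r a = cmp s a \<odot>\<^bsub>C\<^esub> cmp n a"
      using cmp_comp[OF h(5) m a] cmp_comp[OF l h(6) a] cmp_comp[OF h(1) n a]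
        cmp_comp[OF m h(3) a] cmp_comp[OF h(2) m a] cmp_comp[OF n h(4) a] mi nq mr by simp_all
    moreover have "iso C (cmp l a)" "iso C (cmp n a)" using iso_cmp iso l n a by blast+
    moreover have "split_epi C (cmp q a) (cmp r a)" "split_epi C (cmp p a) (cmp s a)"
      using split_epi_pointwise qr ps a by blast+
    moreover have "kernel C (cmp i a) (cmp q a)" "kernel C (cmp k a) (cmp p a)"
      using kernel_pointwise[OF fc pt] i k a by blast+
    moreover have "cmp l a \<in> hom C (Dom C (cmp i a)) (Dom C (cmp k a))"
      "cmp m a \<in> hom C (Dom C (cmp q a)) (Dom C (cmp p a))"
      "cmp n a \<in> hom C (Cod C (cmp q a)) (Cod C (cmp p a))"
      using lmn h'[THEN homD(2)] h'[THEN homD(3)] by simp_all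
    ultimately show "iso C (cmp m a)" using C unfolding split_short_five_lemma_def by blast
  qed
qed

theorem pointed_protomodular:
  assumes "finitely_complete C" "pointed_protomodular C"
  shows "pointed_protomodular D"
  using assms pointed has_pullbacks_of_split_epis split_short_five_lemma
  unfolding pointed_protomodular_def by blast

lemma coequalizer_of_kernel_pair_pointwise:
  assumes C: "regular C" and f: "f \<in> hom D A B" and kp: "kernel_pair D p q f" and a: "a \<in> Ob I"
  shows "\<exists>c. coequalizer C c (cmp p a) (cmp q a)"
proof -
  have fc: "finitely_complete C" using C unfolding regular_def by blast
  have pq: "p \<in> hom D (Dom D p) A" "q \<in> hom D (Dom D p) A"
    using kp homD[OF f] unfolding kernel_pair_def pullback_def hom_def by simp_all
  have "kernel_pair C (cmp p a) (cmp q a) (cmp f a)"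
    using kernel_pair_pointwise[OF fc f pq] kp a by blast
  then show ?thesis using C unfolding regular_def by blast
qed

text \<open>A regular category need not have all coequalizers, so evaluation is not known to preserve an
  arbitrary one. A regular epimorphism is however the coequalizer of its kernel pair, and
  coequalizers of kernel pairs exist, hence are computed pointwise.\<close>

lemma regular_epi_iff_pointwise:
  assumes C: "regular C" and q: "q \<in> hom D A B"
  shows "regular_epi D q \<longleftrightarrow> (\<forall>a \<in> Ob I. regular_epi C (cmp q a))"
proof -
  have fc: "finitely_complete C" using C unfolding regular_def by blast
  obtain p1 p2 where "pullback D p1 p2 q q"
    using D.pullback_exists[OF finitely_complete[OF fc] q q] by blast
  then have kp: "kernel_pair D p1 p2 q" unfolding kernel_pair_def .
  have p: "p1 \<in> hom D (Dom D p1) A" "p2 \<in> hom D (Dom D p1) A"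
    using kp homD[OF q] unfolding kernel_pair_def pullback_def hom_def by simp_all
  have kp': "kernel_pair C (cmp p1 a) (cmp p2 a) (cmp q a)" if "a \<in> Ob I" for a
    using kernel_pair_pointwise[OF fc q p] kp that by blast
  have "regular_epi D q \<longleftrightarrow> coequalizer D q p1 p2"
    using D.coequalizer_of_kernel_pair kp unfolding regular_epi_def by blast
  also have "\<dots> \<longleftrightarrow> (\<forall>a \<in> Ob I. coequalizer C (cmp q a) (cmp p1 a) (cmp p2 a))"
    using coequalizer_iff_pointwise[OF p q] coequalizer_of_kernel_pair_pointwise[OF C q kp] by blast
  also have "\<dots> \<longleftrightarrow> (\<forall>a \<in> Ob I. regular_epi C (cmp q a))"
    using C.coequalizer_of_kernel_pair kp' unfolding regular_epi_def by blast
  finally show ?thesis .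
qed

theorem regular:
  assumes C: "regular C"
  shows "regular D"
  unfolding regular_def
proof (intro conjI allI impI)
  have fc: "finitely_complete C" using C unfolding regular_def by blast
  show "category D" by (rule D.category_axioms)
  show "finitely_complete D" using finitely_complete[OF fc] .
  show "\<exists>c. coequalizer D c p q" if kp: "kernel_pair D p q f" for p q f
  proof -
    have f: "f \<in> hom D (Dom D f) (Cod D f)"
      and pq: "p \<in> hom D (Dom D p) (Dom D f)" "q \<in> hom D (Dom D p) (Dom D f)"
      using kp unfolding kernel_pair_def pullback_def hom_def by simp_all
    show ?thesis
      using coequalizer_exists_pointwise[OF pq coequalizer_of_kernel_pair_pointwise[OF C f kp]] .
  qed
  show "regular_epi D p" if "pullback D p q f g \<and> regular_epi D g" for p q f g
  proof -
    have pb: "pullback D p q f g" and g_epi: "regular_epi D g" using that by blast+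
    note h = pullbackD[OF pb]
    have "pullback C (cmp p a) (cmp q a) (cmp f a) (cmp g a)" if a: "a \<in> Ob I" for a
      using pullback_iff_pointwise[OF h(1-4)] pb a
        C.pullback_exists[OF fc cmp_hom[OF h(1)] cmp_hom[OF h(2)]] by blast
    moreover have "regular_epi C (cmp g a)" if "a \<in> Ob I" for a
      using regular_epi_iff_pointwise[OF C h(2)] g_epi that by blast
    ultimately have "regular_epi C (cmp p a)" if "a \<in> Ob I" for a
      using C that unfolding regular_def by blast
    then show ?thesis using regular_epi_iff_pointwise[OF C h(3)] by blast
  qed
qed

lemma internal_equivalence_pointwise:
  assumes fc: "finitely_complete C" and eq: "internal_equivalence D d e" and a: "a \<in> Ob I"
  shows "internal_equivalence C (cmp d a) (cmp e a)"
proof -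
  define R X where "R = Dom D d" and "X = Cod D d"
  have d: "d \<in> hom D R X" and e: "e \<in> hom D R X"
    using eq unfolding internal_equivalence_def R_def X_def hom_def by simp_all
  have X: "X \<in> Ob D" using D.hom_Ob d by blast
  note d' = cmp_hom[OF d a] and e' = cmp_hom[OF e a]
  have jm: "jointly_monic C (cmp d a) (cmp e a)"
    using jointly_monic_iff_pointwise[OF fc d e] eq a unfolding internal_equivalence_def by blast
  obtain r where r: "r \<in> hom D X R" "d \<odot>\<^bsub>D\<^esub> r = Ide D X" "e \<odot>\<^bsub>D\<^esub> r = Ide D X"
    using eq unfolding internal_equivalence_def R_def X_def by blast
  have refl: "cmp d a \<odot>\<^bsub>C\<^esub> cmp r a = Ide C (obj X a)" "cmp e a \<odot>\<^bsub>C\<^esub> cmp r a = Ide C (obj X a)"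
    using cmp_comp[OF r(1) d a] cmp_comp[OF r(1) e a] r(2,3) cmp_ide[OF X a] by simp_all
  obtain s where s: "s \<in> hom D R R" "d \<odot>\<^bsub>D\<^esub> s = e" "e \<odot>\<^bsub>D\<^esub> s = d"
    using eq unfolding internal_equivalence_def R_def by blast
  have sym: "cmp d a \<odot>\<^bsub>C\<^esub> cmp s a = cmp e a" "cmp e a \<odot>\<^bsub>C\<^esub> cmp s a = cmp d a"
    using cmp_comp[OF s(1) d a] cmp_comp[OF s(1) e a] s(2,3) by simp_all
  obtain p q t where pb: "pullback D p q e d" and t: "t \<in> hom D (Dom D p) R"
    and dt: "d \<odot>\<^bsub>D\<^esub> t = d \<odot>\<^bsub>D\<^esub> p" and et: "e \<odot>\<^bsub>D\<^esub> t = e \<odot>\<^bsub>D\<^esub> q"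
    using eq unfolding internal_equivalence_def R_def by blast
  have p: "p \<in> hom D (Dom D p) R" and q: "q \<in> hom D (Dom D p) R"
    using pullbackD(3,4)[OF pb] pb homD[OF d] homD[OF e] unfolding pullback_def by simp_all
  have pb': "pullback C (cmp p a) (cmp q a) (cmp e a) (cmp d a)"
    using pullback_iff_pointwise[OF e d p q] pb a
      C.pullback_exists[OF fc cmp_hom[OF e] cmp_hom[OF d]] by blast
  have tr: "cmp d a \<odot>\<^bsub>C\<^esub> cmp t a = cmp d a \<odot>\<^bsub>C\<^esub> cmp p a"
    "cmp e a \<odot>\<^bsub>C\<^esub> cmp t a = cmp e a \<odot>\<^bsub>C\<^esub> cmp q a"
    using cmp_comp[OF t d a] cmp_comp[OF t e a] cmp_comp[OF p d a] cmp_comp[OF q e a] dt et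
    by simp_all
  have "cmp t a \<in> hom C (Dom C (cmp p a)) (obj R a)"
    using cmp_hom[OF t a] homD(2)[OF cmp_hom[OF p a]] by simp
  then have "\<exists>t \<in> hom C (Dom C (cmp p a)) (obj R a).
      cmp d a \<odot>\<^bsub>C\<^esub> t = cmp d a \<odot>\<^bsub>C\<^esub> cmp p a \<and> cmp e a \<odot>\<^bsub>C\<^esub> t = cmp e a \<odot>\<^bsub>C\<^esub> cmp q a"
    using tr by blast
  moreover have "\<exists>r \<in> hom C (obj X a) (obj R a).
      cmp d a \<odot>\<^bsub>C\<^esub> r = Ide C (obj X a) \<and> cmp e a \<odot>\<^bsub>C\<^esub> r = Ide C (obj X a)"
    using refl cmp_hom[OF r(1) a] by blast
  moreover have "\<exists>s \<in> hom C (obj R a) (obj R a).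
      cmp d a \<odot>\<^bsub>C\<^esub> s = cmp e a \<and> cmp e a \<odot>\<^bsub>C\<^esub> s = cmp d a"
    using sym cmp_hom[OF s(1) a] by blast
  ultimately show ?thesis
    unfolding internal_equivalence_def homD(2)[OF d'] homD(3)[OF d']
    using homD(1)[OF d'] e' jm pb' by auto
qed

text \<open>At each object of \<open>I\<close> an equivalence relation is the kernel pair of some arrow, but these
  arrows need not be chosen naturally. Coequalizers can, and a kernel pair is also the kernel pair of
  its coequalizer.\<close>

theorem exact:
  assumes C: "exact C"
  shows "exact D"
  unfolding exact_def
proof (intro conjI allI impI)
  have reg: "regular C" using C unfolding exact_def by blast
  then have fc: "finitely_complete C" unfolding regular_def by blast
  show "regular D" using regular[OF reg] .
  fix d e assume eq: "internal_equivalence D d e"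
  have d: "d \<in> hom D (Dom D d) (Cod D d)" and e: "e \<in> hom D (Dom D d) (Cod D d)"
    using eq unfolding internal_equivalence_def hom_def by simp_all
  have kp: "\<exists>f. kernel_pair C (cmp d a) (cmp e a) f" if "a \<in> Ob I" for a
    using C internal_equivalence_pointwise[OF fc eq that] unfolding exact_def by blast
  then have coeq: "\<exists>c. coequalizer C c (cmp d a) (cmp e a)" if "a \<in> Ob I" for a
    using reg that unfolding regular_def by blast
  obtain c where c: "coequalizer D c d e" using coequalizer_exists_pointwise[OF d e coeq] by blast
  have c_hom: "c \<in> hom D (Cod D d) (Cod D c)" using c unfolding coequalizer_def hom_def by simp
  have "coequalizer C (cmp c a) (cmp d a) (cmp e a)" if "a \<in> Ob I" for a
    using coequalizer_iff_pointwise[OF d e c_hom coeq] c that by blast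
  then have "kernel_pair C (cmp d a) (cmp e a) (cmp c a)" if "a \<in> Ob I" for a
    using C.kernel_pair_of_coequalizer kp that by blast
  then show "\<exists>f. kernel_pair D d e f" using kernel_pair_pointwise[OF fc c_hom d e] by blast
qed

end

section \<open>The category of functors\<close>

lemma functor_cat_simps [simp]:
  "Ob (functor_cat I C) = {F. is_functor I C F}"
  "Ar (functor_cat I C) = {t. is_nat_trans I C t}"
  "Dom (functor_cat I C) = NDom" "Cod (functor_cat I C) = NCod"
  "Ide (functor_cat I C) F = \<lparr> NDom = F, NCod = F, NComp = (\<lambda>a \<in> Ob I. Ide C (FOb F a)) \<rparr>"
  "t \<odot>\<^bsub>functor_cat I C\<^esub> s = \<lparr> NDom = NDom s, NCod = NCod t,
     NComp = (\<lambda>a \<in> Ob I. NComp t a \<odot>\<^bsub>C\<^esub> NComp s a) \<rparr>"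
  by (simp_all add: functor_cat_def)

lemma ntr_eqI:
  fixes s t :: "('i, 'j, 'o, 'm) ntr"
  assumes "NDom s = NDom t" "NCod s = NCod t" "NComp s = NComp t"
  shows "s = t"
  using assms by (cases s, cases t) simp

lemma is_functorD:
  assumes "is_functor I C F"
  shows "a \<in> Ob I \<Longrightarrow> FOb F a \<in> Ob C"
    and "f \<in> hom I a b \<Longrightarrow> FAr F f \<in> hom C (FOb F a) (FOb F b)"
    and "a \<in> Ob I \<Longrightarrow> FAr F (Ide I a) = Ide C (FOb F a)"
    and "f \<in> hom I a b \<Longrightarrow> g \<in> hom I b c \<Longrightarrow> FAr F (g \<odot>\<^bsub>I\<^esub> f) = FAr F g \<odot>\<^bsub>C\<^esub> FAr F f"
  using assms unfolding is_functor_def hom_def by auto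

lemma hom_functor_cat:
  "t \<in> hom (functor_cat I C) F G \<longleftrightarrow> NDom t = F \<and> NCod t = G \<and> is_functor I C F \<and> is_functor I C G \<and>
     NComp t \<in> extensional (Ob I) \<and> (\<forall>a \<in> Ob I. NComp t a \<in> hom C (FOb F a) (FOb G a)) \<and>
     (\<forall>f \<in> Ar I. NComp t (Cod I f) \<odot>\<^bsub>C\<^esub> FAr F f = FAr G f \<odot>\<^bsub>C\<^esub> NComp t (Dom I f))"
  unfolding hom_def[of "functor_cat I C"] by (auto simp: is_nat_trans_def)

lemma category_functor_cat:
  fixes I :: "('i, 'j) cat" and C :: "('o, 'm) cat"
  assumes "category I" "category C"
  shows "category (functor_cat I C)"
proof -
  interpret I: category I by fact
  interpret C: category C by fact
  let ?D = "functor_cat I C"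
  show ?thesis
  proof
    show "Dom ?D t \<in> Ob ?D" "Cod ?D t \<in> Ob ?D" if "t \<in> Ar ?D" for t
      using that by (simp_all add: is_nat_trans_def)
    show "Ide ?D F \<in> hom ?D F F" if "F \<in> Ob ?D" for F
    proof -
      have F: "is_functor I C F" using that by simp
      have "Ide C (FOb F (Cod I f)) \<odot>\<^bsub>C\<^esub> FAr F f = FAr F f \<odot>\<^bsub>C\<^esub> Ide C (FOb F (Dom I f))"
        if "f \<in> Ar I" for f
        using C.comp_ide_left C.comp_ide_right is_functorD(2)[OF F hom_self[OF that]] by metis
      then show ?thesis
        using F is_functorD(1)[OF F] C.ide_in_hom I.dom_in_Ob I.cod_in_Ob
        by (simp add: hom_functor_cat)
    qed
    show "t \<odot>\<^bsub>?D\<^esub> s \<in> hom ?D F H" if s: "s \<in> hom ?D F G" and t: "t \<in> hom ?D G H" for s t F G H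
    proof -
      have FGH: "is_functor I C F" "is_functor I C G" "is_functor I C H"
        using s t unfolding hom_functor_cat by blast+
      have hs: "NComp s a \<in> hom C (FOb F a) (FOb G a)" and ht: "NComp t a \<in> hom C (FOb G a) (FOb H a)"
        if "a \<in> Ob I" for a
        using s t that unfolding hom_functor_cat by blast+
      have "(NComp t (Cod I f) \<odot>\<^bsub>C\<^esub> NComp s (Cod I f)) \<odot>\<^bsub>C\<^esub> FAr F f =
          FAr H f \<odot>\<^bsub>C\<^esub> (NComp t (Dom I f) \<odot>\<^bsub>C\<^esub> NComp s (Dom I f))" if f: "f \<in> Ar I" for f
      proof -
        note o = I.dom_in_Ob[OF f] I.cod_in_Ob[OF f]
        note a = FGH[THEN is_functorD(2), OF hom_self[OF f]]
        have ns: "NComp s (Cod I f) \<odot>\<^bsub>C\<^esub> FAr F f = FAr G f \<odot>\<^bsub>C\<^esub> NComp s (Dom I f)"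
          and nt: "NComp t (Cod I f) \<odot>\<^bsub>C\<^esub> FAr G f = FAr H f \<odot>\<^bsub>C\<^esub> NComp t (Dom I f)"
          using s t f unfolding hom_functor_cat by blast+
        show ?thesis
          using C.comp_assoc[OF a(1) hs[OF o(2)] ht[OF o(2)]] C.comp_assoc[OF hs[OF o(1)] a(2) ht[OF o(2)]]
            C.comp_assoc[OF hs[OF o(1)] ht[OF o(1)] a(3)] ns nt by simp
      qed
      then show ?thesis
        using s t C.comp_in_hom[OF hs ht] I.dom_in_Ob I.cod_in_Ob by (simp add: hom_functor_cat)
    qed
    show "Ide ?D G \<odot>\<^bsub>?D\<^esub> t = t" "t \<odot>\<^bsub>?D\<^esub> Ide ?D F = t" if t: "t \<in> hom ?D F G" for t F G
    proof -
      have h: "NComp t a \<in> hom C (FOb F a) (FOb G a)" if "a \<in> Ob I" for a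
        using t that unfolding hom_functor_cat by blast
      have "NComp t \<in> extensional (Ob I)" "NDom t = F" "NCod t = G"
        using t unfolding hom_functor_cat by blast+
      then show "Ide ?D G \<odot>\<^bsub>?D\<^esub> t = t" "t \<odot>\<^bsub>?D\<^esub> Ide ?D F = t"
        using C.comp_ide_left[OF h] C.comp_ide_right[OF h]
        by (auto intro!: ntr_eqI extensionalityI[of _ "Ob I"])
    qed
    show "(u \<odot>\<^bsub>?D\<^esub> t) \<odot>\<^bsub>?D\<^esub> s = u \<odot>\<^bsub>?D\<^esub> (t \<odot>\<^bsub>?D\<^esub> s)"
      if "s \<in> hom ?D F G" "t \<in> hom ?D G H" "u \<in> hom ?D H K" for s t u F G H K
    proof -
      have h: "NComp s a \<in> hom C (FOb F a) (FOb G a)" "NComp t a \<in> hom C (FOb G a) (FOb H a)"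
        "NComp u a \<in> hom C (FOb H a) (FOb K a)" if "a \<in> Ob I" for a
        using \<open>s \<in> _\<close> \<open>t \<in> _\<close> \<open>u \<in> _\<close> that unfolding hom_functor_cat by blast+
      then show ?thesis
        using C.comp_assoc[OF h] by (auto intro!: ntr_eqI extensionalityI[of _ "Ob I"])
    qed
  qed
qed

lemma functor_category_functor_cat:
  fixes I :: "('i, 'j) cat" and C :: "('o, 'm) cat"
  assumes "category I" "category C"
  shows "functor_category I C (functor_cat I C) FOb FAr NComp"
proof -
  interpret I: category I by fact
  interpret C: category C by fact
  let ?D = "functor_cat I C"
  interpret D: category ?D by (rule category_functor_cat) fact+
  show ?thesis
  proof
    fix X :: "'i \<Rightarrow> 'o" and \<phi> :: "'j \<Rightarrow> 'm"
    assume X: "\<And>a. a \<in> Ob I \<Longrightarrow> X a \<in> Ob C"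
      and \<phi>: "\<And>f a b. f \<in> hom I a b \<Longrightarrow> \<phi> f \<in> hom C (X a) (X b)"
      and ide: "\<And>a. a \<in> Ob I \<Longrightarrow> \<phi> (Ide I a) = Ide C (X a)"
      and comp: "\<And>f g a b c. f \<in> hom I a b \<Longrightarrow> g \<in> hom I b c
                 \<Longrightarrow> \<phi> (g \<odot>\<^bsub>I\<^esub> f) = \<phi> g \<odot>\<^bsub>C\<^esub> \<phi> f"
    let ?F = "\<lparr> FOb = restrict X (Ob I), FAr = restrict \<phi> (Ar I) \<rparr>"
    have "is_functor I C ?F"
      unfolding is_functor_def
    proof (intro conjI ballI impI)
      show "FOb ?F \<in> Ob I \<rightarrow>\<^sub>E Ob C" using X by simp
      show "FAr ?F \<in> Ar I \<rightarrow>\<^sub>E Ar C" using homD(1)[OF \<phi>[OF hom_self]] by simp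
      show "FAr ?F f \<in> hom C (FOb ?F (Dom I f)) (FOb ?F (Cod I f))" if "f \<in> Ar I" for f
        using that \<phi>[OF hom_self] I.dom_in_Ob I.cod_in_Ob by simp
      show "FAr ?F (Ide I a) = Ide C (FOb ?F a)" if "a \<in> Ob I" for a
        using that ide homD(1)[OF I.ide_in_hom] by simp
      fix f g assume fg: "f \<in> Ar I" "g \<in> Ar I" "Dom I g = Cod I f"
      then have h: "f \<in> hom I (Dom I f) (Cod I f)" "g \<in> hom I (Cod I f) (Cod I g)"
        by (simp_all add: hom_def)
      show "FAr ?F (g \<odot>\<^bsub>I\<^esub> f) = FAr ?F g \<odot>\<^bsub>C\<^esub> FAr ?F f"
        using fg comp[OF h] homD(1)[OF I.comp_in_hom[OF h]] by simp
    qed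
    then show "\<exists>F \<in> Ob ?D. (\<forall>a \<in> Ob I. FOb F a = X a) \<and> (\<forall>f \<in> Ar I. FAr F f = \<phi> f)"
      by (intro bexI[of _ ?F]) simp_all
  next
    fix F G and \<tau> :: "'i \<Rightarrow> 'm"
    assume FG: "F \<in> Ob ?D" "G \<in> Ob ?D"
      and \<tau>: "\<And>a. a \<in> Ob I \<Longrightarrow> \<tau> a \<in> hom C (FOb F a) (FOb G a)"
      and nat: "\<And>f a b. f \<in> hom I a b \<Longrightarrow> \<tau> b \<odot>\<^bsub>C\<^esub> FAr F f = FAr G f \<odot>\<^bsub>C\<^esub> \<tau> a"
    have "\<lparr> NDom = F, NCod = G, NComp = restrict \<tau> (Ob I) \<rparr> \<in> hom ?D F G"
      using FG \<tau> nat[OF hom_self] I.dom_in_Ob I.cod_in_Ob by (simp add: hom_functor_cat)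
    then show "\<exists>t \<in> hom ?D F G. \<forall>a \<in> Ob I. NComp t a = \<tau> a"
      by (rule bexI[rotated]) simp
  next
    fix s t F G assume st: "s \<in> hom ?D F G" "t \<in> hom ?D F G"
      and eq: "\<And>a. a \<in> Ob I \<Longrightarrow> NComp s a = NComp t a"
    have "NComp s = NComp t"
      by (rule extensionalityI[of _ "Ob I"]) (use st eq in \<open>auto simp: hom_functor_cat\<close>)
    then show "s = t" using st by (auto simp: hom_functor_cat intro: ntr_eqI)
  next
    fix t F G f a b assume t: "t \<in> hom ?D F G" and f: "f \<in> hom I a b"
    then show "NComp t b \<odot>\<^bsub>C\<^esub> FAr F f = FAr G f \<odot>\<^bsub>C\<^esub> NComp t a"
      using homD[OF f] unfolding hom_functor_cat by blast
  qed (auto simp: is_functorD hom_functor_cat)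
qed

theorem theorem7:
  fixes I :: "('i, 'j) cat" and C :: "('o, 'm) cat"
  assumes "category I" and "category C" and "finitely_complete C"
  shows "(pointed_protomodular C \<longrightarrow> pointed_protomodular (functor_cat I C)) \<and>
         (homological C \<longrightarrow> homological (functor_cat I C)) \<and>
         (finitely_cocomplete C \<and> homological C \<longrightarrow>
            finitely_cocomplete (functor_cat I C) \<and> homological (functor_cat I C)) \<and>
         (semi_abelian C \<longrightarrow> semi_abelian (functor_cat I C))"
proof -
  interpret functor_category I C "functor_cat I C" FOb FAr NComp
    by (rule functor_category_functor_cat) fact+
  have protomodular: "pointed_protomodular C \<Longrightarrow> pointed_protomodular (functor_cat I C)"
    using pointed_protomodular assms(3) by blast
  have homological: "homological C \<Longrightarrow> homological (functor_cat I C)"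
    unfolding homological_def using pointed regular protomodular by blast
  have cocomplete: "finitely_cocomplete C \<Longrightarrow> finitely_cocomplete (functor_cat I C)"
    unfolding finitely_cocomplete_opp
    by (rule functor_category.finitely_complete[OF functor_category_opp])
  have "semi_abelian C \<Longrightarrow> semi_abelian (functor_cat I C)"
    unfolding semi_abelian_def using pointed exact protomodular has_finite_coproducts by blast
  then show ?thesis using protomodular homological cocomplete by blast
qed

end
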